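(* Let $\rho_S$ be a symmetric two-qubit state with spectrum $\tau_1\ge\tau_2\ge\tau_3$ (its three eigenvalues on the symmetric subspace). Then $$\max_{U_S\in SU(3)}\mathcal N\left(U_S\rho_S U_S^\dagger\right)=\max\Big(0,\ \sqrt{\tau_1^2+(\tau_2-\tau_3)^2}-\tau_2-\tau_3\Big),$$ and the maximum negativity is reached by the state $\tilde\rho_S=U_S\rho_SU_S^\dagger$ given, up to local unitary transformations, by $$\tilde\rho_S=\tau_3\,|D_2^{(0)}\rangle\langle D_2^{(0)}|+\tau_1\,|D_2^{(1)}\rangle\langle D_2^{(1)}|+\tau_2\,|D_2^{(2)}\rangle\langle D_2^{(2)}|.$$
   Context: Let $\mathcal H_1=\mathbb C^2$ with orthonormal basis $|+\rangle,|-\rangle$. The symmetric subspace $\mathcal H_1^{\vee 2}\subset\mathcal H_1\otimes\mathcal H_1$ is the 3-dimensional space of vectors invariant under exchange of the two qubits, with orthonormal (Dicke) basis $|D_2^{(0)}\rangle=|+\rangle\otimes|+\rangle$, $|D_2^{(1)}\rangle=\frac1{\sqrt2}(|+\rangle\otimes|-\rangle+|-\rangle\otimes|+\rangle)$, $|D_2^{(2)}\rangle=|-\rangle\otimes|-\rangle$. A symmetric two-qubit state is a density operator $\rho_S$ (positive semidefinite, unit trace) on $\mathcal H_1\otimes\mathcal H_1$ with $\rho_S=P_S\rho_SP_S$, where $P_S$ is the orthogonal projector onto $\mathcal H_1^{\vee2}$; equivalently a density operator on $\mathcal H_1^{\vee 2}\simeq\mathbb C^3$. $SU(3)$ denotes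 the special unitary group of $\mathcal H_1^{\vee2}$, i.e. the global unitaries acting within the symmetric subspace. The negativity of a two-qubit state $\rho$ is $\mathcal N(\rho)=\lVert\rho^{T_A}\rVert_1-1=\sum_k(|\Lambda_k|-\Lambda_k)$, where $\rho^{T_A}$ is the partial transpose with respect to the first qubit, $\Lambda_k$ are its eigenvalues and $\lVert X\rVert_1=\mathrm{Tr}\sqrt{X^\dagger X}$. Local unitary transformations preserving the symmetric subspace are those of the form $V\otimes V$ with $V$ unitary on $\mathcal H_1$; they do not change the negativity. *)

theory Defs
  imports "Jordan_Normal_Form.Schur_Decomposition"
begin

(* Tensor products use the big-endian index convention: for v of dimension m and w of
   dimension n, the basis vector e_i (x) e_j has index i * n + j. *)

definition tensor_vec :: "complex vec \<Rightarrow> complex vec \<Rightarrow> complex vec"  (infixl \<open>\<otimes>\<^sub>v\<close> 70) where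
  "v \<otimes>\<^sub>v w = vec (dim_vec v * dim_vec w)
     (\<lambda>k. v $ (k div dim_vec w) * w $ (k mod dim_vec w))"

definition tensor_mat :: "complex mat \<Rightarrow> complex mat \<Rightarrow> complex mat"  (infixl \<open>\<otimes>\<^sub>m\<close> 70) where
  "A \<otimes>\<^sub>m B = mat (dim_row A * dim_row B) (dim_col A * dim_col B)
     (\<lambda>(r, s). A $$ (r div dim_row B, s div dim_col B) * B $$ (r mod dim_row B, s mod dim_col B))"

definition ket_bra :: "complex vec \<Rightarrow> complex vec \<Rightarrow> complex mat" where
  "ket_bra v w = mat (dim_vec v) (dim_vec w) (\<lambda>(i, j). v $ i * conjugate (w $ j))"

definition mat_trace :: "complex mat \<Rightarrow> complex" where
  "mat_trace A = (\<Sum>i<dim_row A. A $$ (i, i))"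

definition unitary_mat :: "nat \<Rightarrow> complex mat \<Rightarrow> bool" where
  "unitary_mat n U \<longleftrightarrow> U \<in> carrier_mat n n \<and> U * mat_adjoint U = 1\<^sub>m n \<and> mat_adjoint U * U = 1\<^sub>m n"

(* The order on complex numbers is that of Complex_Order: 0 \<le> z means that z is real and
   nonnegative. *)
definition psd_mat :: "nat \<Rightarrow> complex mat \<Rightarrow> bool" where
  "psd_mat n A \<longleftrightarrow> A \<in> carrier_mat n n \<and> mat_adjoint A = A \<and>
     (\<forall>v \<in> carrier_vec n. 0 \<le> (A *\<^sub>v v) \<bullet>c v)"

definition density_mat :: "nat \<Rightarrow> complex mat \<Rightarrow> bool" where
  "density_mat n \<rho> \<longleftrightarrow> psd_mat n \<rho> \<and> mat_trace \<rho> = 1"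

(* Meaningful for positive semidefinite A, whose positive semidefinite square root is unique. *)
definition psd_sqrt :: "complex mat \<Rightarrow> complex mat" where
  "psd_sqrt A = (THE B. psd_mat (dim_row A) B \<and> B * B = A)"

(* The trace of a positive semidefinite matrix is real, so Re loses nothing. *)
definition trace_norm :: "complex mat \<Rightarrow> real" where
  "trace_norm X = Re (mat_trace (psd_sqrt (mat_adjoint X * X)))"

(* Transposition of the first qubit: <a b| \<rho>^T_A |a' b'> = <a' b| \<rho> |a b'>,
   with r = 2 a + b and s = 2 a' + b'. *)
definition partial_transpose_A :: "complex mat \<Rightarrow> complex mat" where
  "partial_transpose_A \<rho> =
     mat 4 4 (\<lambda>(r, s). \<rho> $$ (2 * (s div 2) + r mod 2, 2 * (r div 2) + s mod 2))"

definition negativity :: "complex mat \<Rightarrow> real" where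
  "negativity \<rho> = trace_norm (partial_transpose_A \<rho>) - 1"

definition ket_plus :: "complex vec" where
  "ket_plus = unit_vec 2 0"

definition ket_minus :: "complex vec" where
  "ket_minus = unit_vec 2 1"

definition dicke0 :: "complex vec" where
  "dicke0 = ket_plus \<otimes>\<^sub>v ket_plus"

definition dicke1 :: "complex vec" where
  "dicke1 = complex_of_real (1 / sqrt 2) \<cdot>\<^sub>v (ket_plus \<otimes>\<^sub>v ket_minus + ket_minus \<otimes>\<^sub>v ket_plus)"

definition dicke2 :: "complex vec" where
  "dicke2 = ket_minus \<otimes>\<^sub>v ket_minus"

(* The isometry from C^3 onto the symmetric subspace that sends the standard basis to the
   Dicke basis. *)
definition dicke_isometry :: "complex mat" where
  "dicke_isometry = mat_of_cols 4 [dicke0, dicke1, dicke2]"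

(* The orthogonal projector onto the symmetric subspace; see sym_proj_fixes_iff. *)
definition sym_proj :: "complex mat" where
  "sym_proj = ket_bra dicke0 dicke0 + ket_bra dicke1 dicke1 + ket_bra dicke2 dicke2"

definition symmetric_state :: "complex mat \<Rightarrow> bool" where
  "symmetric_state \<rho> \<longleftrightarrow> density_mat 4 \<rho> \<and> \<rho> = sym_proj * \<rho> * sym_proj"

(* Matrix, in the Dicke basis, of the compression of an operator to the symmetric subspace. *)
definition sym_restrict :: "complex mat \<Rightarrow> complex mat" where
  "sym_restrict A = mat_adjoint dicke_isometry * A * dicke_isometry"

(* Operator with Dicke-basis matrix A on the symmetric subspace, and zero on its orthogonal
   complement. *)
definition sym_extend :: "complex mat \<Rightarrow> complex mat" where
  "sym_extend A = dicke_isometry * A * mat_adjoint dicke_isometry"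

definition SU3_sym :: "complex mat set" where
  "SU3_sym = sym_extend ` {U. unitary_mat 3 U \<and> det U = 1}"

definition conj_by :: "complex mat \<Rightarrow> complex mat \<Rightarrow> complex mat" where
  "conj_by U \<rho> = U * \<rho> * mat_adjoint U"

definition swap_mat :: "complex mat" where
  "swap_mat = mat 4 4 (\<lambda>(r, s). if r = 2 * (s mod 2) + s div 2 then 1 else 0)"


lemma less4: "(i::nat) < 4 \<longleftrightarrow> i = 0 \<or> i = 1 \<or> i = 2 \<or> i = 3"
  by auto

lemma sum4: "sum f {0..<4::nat} = f 0 + f 1 + f 2 + (f 3 :: complex)"
  by (simp add: eval_nat_numeral)

lemma all4: "(\<forall>i<4::nat. P i) \<longleftrightarrow> P 0 \<and> P 1 \<and> P 2 \<and> P 3"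
  by (auto simp: less4)

lemma swap_mat_tensor:
  assumes "v \<in> carrier_vec 2" "w \<in> carrier_vec 2"
  shows "swap_mat *\<^sub>v (v \<otimes>\<^sub>v w) = w \<otimes>\<^sub>v v"
  using assms
  by (intro eq_vecI) (auto simp: swap_mat_def tensor_vec_def scalar_prod_def less4 sum4)

lemma dicke_entries:
  "dicke0 = vec 4 (\<lambda>i. if i = 0 then 1 else 0)"
  "dicke1 = vec 4 (\<lambda>i. if i = 1 \<or> i = 2 then complex_of_real (1 / sqrt 2) else 0)"
  "dicke2 = vec 4 (\<lambda>i. if i = 3 then 1 else 0)"
  by (simp_all add: dicke0_def dicke1_def dicke2_def ket_plus_def ket_minus_def
      tensor_vec_def unit_vec_def vec_eq_iff all4)

lemma sym_proj_entries:
  "sym_proj = mat 4 4 (\<lambda>(i, j). if i = j \<and> (i = 0 \<or> i = 3) then 1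
     else if (i = 1 \<or> i = 2) \<and> (j = 1 \<or> j = 2) then 1 / 2 else 0)"
proof -
  have "complex_of_real (sqrt 2) * complex_of_real (sqrt 2) = 2"
    by (simp flip: of_real_mult)
  then show ?thesis
    by (simp add: sym_proj_def ket_bra_def dicke_entries mat_eq_iff all4)
qed

lemma sym_proj_projector: "mat_adjoint sym_proj = sym_proj" "sym_proj * sym_proj = sym_proj"
  by (simp_all add: sym_proj_entries mat_adjoint_def mat_of_rows_def mat_eq_iff all4
      scalar_prod_def sum4)

lemma sym_proj_fixes_iff:
  assumes "v \<in> carrier_vec 4"
  shows "sym_proj *\<^sub>v v = v \<longleftrightarrow> swap_mat *\<^sub>v v = v"
proof -
  have "sym_proj *\<^sub>v v = v \<longleftrightarrow> v $ 1 = v $ 2"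
    using assms
    by (auto simp: sym_proj_entries vec_eq_iff all4 scalar_prod_def sum4 field_simps)
  moreover have "swap_mat *\<^sub>v v = v \<longleftrightarrow> v $ 1 = v $ 2"
    using assms by (auto simp: swap_mat_def vec_eq_iff all4 scalar_prod_def sum4)
  ultimately show ?thesis by simp
qed

lemma dicke_isometry_props:
  "mat_adjoint dicke_isometry * dicke_isometry = 1\<^sub>m 3"
  "dicke_isometry * mat_adjoint dicke_isometry = sym_proj"
proof -
  have half: "complex_of_real (sqrt 2) * complex_of_real (sqrt 2) = 2"
    by (simp flip: of_real_mult)
  have D: "dicke_isometry = mat 4 3 (\<lambda>(i, j). ([dicke0, dicke1, dicke2] ! j) $ i)"
    by (simp add: dicke_isometry_def mat_of_cols_def numeral_3_eq_3)
  have all3: "(\<forall>i<3::nat. P i) \<longleftrightarrow> P 0 \<and> P 1 \<and> P 2" for P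
    by (auto simp: numeral_3_eq_3 less_Suc_eq numeral_2_eq_2)
  have sum3: "sum f {0..<3::nat} = f 0 + f 1 + (f 2 :: complex)" for f
    by (simp add: eval_nat_numeral)
  show "mat_adjoint dicke_isometry * dicke_isometry = 1\<^sub>m 3"
    by (simp add: D dicke_entries mat_adjoint_def mat_of_rows_def mat_eq_iff all3
        scalar_prod_def sum4 half)
  show "dicke_isometry * mat_adjoint dicke_isometry = sym_proj"
    by (simp add: D sym_proj_entries dicke_entries mat_adjoint_def mat_of_rows_def mat_eq_iff all4
        scalar_prod_def sum3 half)
qed

end

theory Submission
  imports Defs
begin

text \<open>
  For positive semidefinite \<open>\<rho>\<close> the partial transpose has at most one negative eigenvalue, so the
  negativity is twice the modulus of the least eigenvalue, if that is negative, and it suffices to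
  bound the quadratic form of the partial transpose from below.

  Expanding \<open>\<rho> = \<Sum> \<tau>k |\<psi>k><\<psi>k|\<close> and writing the test vector \<open>\<phi>\<close> in the basis \<open>1, \<sigma>\<close> with complex
  coordinates \<open>z = (z0, z1, z2, z3)\<close> and the symmetric vectors \<open>\<psi>k\<close> in the basis of the three
  symmetric Bell states, the form splits into the contributions of \<open>Re z\<close> and \<open>Im z\<close>. For real
  \<open>z = (c, t)\<close> it equals, up to scaling, \<open>|z|\<^sup>2 / 2 - Tr (\<rho> M)\<close>, where the Hermitian 3 by 3 matrix \<open>M\<close> has
  eigenvalues \<open>|t|\<^sup>2, c |t|, - c |t|\<close>. Bounding \<open>Tr (\<rho> M)\<close> by rearrangement and maximising over
  the angle of the plane vector \<open>(c, |t|)\<close> gives \<open>(\<tau>1 + sqrt (\<tau>1\<^sup>2 + (\<tau>2 - \<tau>3)\<^sup>2)) / 2\<close>. The bound is an eigenvalue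
  of the partial transpose of the Dicke mixture.
\<close>

section \<open>Unitary matrices and the spectral theorem\<close>


text \<open>In the basis formed from 1 and \<open>\<sigma>\<close> the partial transpose of a
  symmetric state is a real symmetric matrix. This is why \<open>Re z\<close> and
  \<open>Im z\<close> do not interact and only real (c, t) need an estimate. Orthonormal bases of
  the symmetric subspace become orthogonal frames of C^3, so the group orbit is covered by a bound
  uniform over all frames. No compactness enters: this bound is compared with one explicit state.

  The radical is the length of (\<tau>1, \<tau>2 - \<tau>3). For c <= |t| the bound on Tr (rho M) is
  affine in the cosine and sine of the doubled angle of (c, |t|), and Cauchy-Schwarz is sharp at one
  angle. For the Dicke mixture the radicand is the discriminant of the block with rows (\<tau>3,
  \<tau>1/2) and (\<tau>1/2, \<tau>2) that couples |++> and |-->.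

  The trace norm is defined by a description operator for the positive square root, so evaluating it
  rests on uniqueness of that root and on unitary diagonalisation. The eigenvalue order there must
  be free: the spectrum is sorted for the bound but permuted in the Dicke mixture.\<close>

lemma mat_adjoint_eq: "mat_adjoint A = mat (dim_col A) (dim_row A) (\<lambda>(i, j). cnj (A $$ (j, i)))"
  by (auto simp: mat_adjoint_def mat_of_rows_def)

lemma mat_adjoint_dim [simp]:
  "dim_row (mat_adjoint A) = dim_col A" "dim_col (mat_adjoint (A::complex mat)) = dim_row A"
  by (simp_all add: mat_adjoint_eq)

lemma mat_adjoint_carrier [simp, intro]:
  "A \<in> carrier_mat m n \<Longrightarrow> mat_adjoint (A::complex mat) \<in> carrier_mat n m"
  by (intro carrier_matI) simp_all

lemma mat_adjoint_index [simp]: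
  "i < dim_col A \<Longrightarrow> j < dim_row A \<Longrightarrow> mat_adjoint A $$ (i, j) = cnj (A $$ (j, i))"
  by (simp add: mat_adjoint_eq)

lemma mat_adjoint_adjoint [simp]: "mat_adjoint (mat_adjoint (A::complex mat)) = A"
  by (rule eq_matI) auto

lemma index_mult_mat_sum:
  fixes A B :: "complex mat"
  assumes "A \<in> carrier_mat m n" "B \<in> carrier_mat n l" "i < m" "j < l"
  shows "(A * B) $$ (i, j) = (\<Sum>k<n. A $$ (i, k) * B $$ (k, j))"
  using assms by (auto simp: scalar_prod_def atLeast0LessThan)

lemma mat_adjoint_mult:
  fixes A B :: "complex mat"
  assumes A: "A \<in> carrier_mat m n" and B: "B \<in> carrier_mat n l"
  shows "mat_adjoint (A * B) = mat_adjoint B * mat_adjoint A"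
proof (rule eq_matI)
  fix i j assume "i < dim_row (mat_adjoint B * mat_adjoint A)" "j < dim_col (mat_adjoint B * mat_adjoint A)"
  then have ij: "i < l" "j < m" using A B by auto
  have "mat_adjoint (A * B) $$ (i, j) = cnj (\<Sum>k<n. A $$ (j, k) * B $$ (k, i))"
    using ij A B index_mult_mat_sum[OF A B] by auto
  also have "\<dots> = (\<Sum>k<n. mat_adjoint B $$ (i, k) * mat_adjoint A $$ (k, j))"
    unfolding cnj_sum using ij A B by (intro sum.cong) auto
  also have "\<dots> = (mat_adjoint B * mat_adjoint A) $$ (i, j)"
    using index_mult_mat_sum[of "mat_adjoint B" l n "mat_adjoint A" m i j] ij A B by auto
  finally show "mat_adjoint (A * B) $$ (i, j) = (mat_adjoint B * mat_adjoint A) $$ (i, j)" .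
qed (use A B in auto)

lemma mat_adjoint_one [simp]: "mat_adjoint (1\<^sub>m n) = (1\<^sub>m n :: complex mat)"
  by (rule eq_matI) auto

lemma unitary_matD:
  assumes "unitary_mat n U"
  shows "U \<in> carrier_mat n n" "U * mat_adjoint U = 1\<^sub>m n" "mat_adjoint U * U = 1\<^sub>m n"
  using assms by (auto simp: unitary_mat_def)

lemma unitary_matI:
  assumes U: "U \<in> carrier_mat n n" and "mat_adjoint U * U = 1\<^sub>m n"
  shows "unitary_mat n U"
  using assms mat_mult_left_right_inverse[of "mat_adjoint U" n U] by (auto simp: unitary_mat_def)

lemma unitary_mat_adjoint: "unitary_mat n U \<Longrightarrow> unitary_mat n (mat_adjoint U)"
  by (auto simp: unitary_mat_def)

lemma unitary_mat_mult:
  assumes "unitary_mat n U" "unitary_mat n V"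
  shows "unitary_mat n (U * V)"
proof (rule unitary_matI)
  note U = unitary_matD[OF assms(1)] and V = unitary_matD[OF assms(2)]
  have "mat_adjoint (U * V) * (U * V) = mat_adjoint V * (mat_adjoint U * (U * V))"
    using U(1) V(1) by (simp add: mat_adjoint_mult[of _ n n] assoc_mult_mat[of _ n n _ n _ n])
  also have "mat_adjoint U * (U * V) = V"
    using U V by (simp flip: assoc_mult_mat[of _ n n _ n _ n])
  finally show "mat_adjoint (U * V) * (U * V) = 1\<^sub>m n" using V by simp
  show "U * V \<in> carrier_mat n n" using U V by simp
qed

lemma unitary_cols:
  assumes U: "U \<in> carrier_mat n n"
    and on: "\<And>i j. i < n \<Longrightarrow> j < n \<Longrightarrow> (\<Sum>k<n. cnj (U $$ (k, i)) * U $$ (k, j)) = (if i = j then 1 else 0)"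
  shows "unitary_mat n U"
proof (rule unitary_matI[OF U], rule eq_matI)
  fix i j assume "i < dim_row (1\<^sub>m n :: complex mat)" "j < dim_col (1\<^sub>m n :: complex mat)"
  then have ij: "i < n" "j < n" by auto
  then show "(mat_adjoint U * U) $$ (i, j) = 1\<^sub>m n $$ (i, j)"
    using on[OF ij] index_mult_mat_sum[of "mat_adjoint U" n n U n i j] U by auto
qed (use U in auto)

lemma isometry_cols:
  fixes U :: "complex mat"
  assumes U: "U \<in> carrier_mat n m" and iso: "mat_adjoint U * U = 1\<^sub>m m" and ij: "i < m" "j < m"
  shows "(\<Sum>k<n. cnj (U $$ (k, i)) * U $$ (k, j)) = (if i = j then 1 else 0)"
proof -
  have "(\<Sum>k<n. cnj (U $$ (k, i)) * U $$ (k, j)) = (mat_adjoint U * U) $$ (i, j)"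
    using index_mult_mat_sum[of "mat_adjoint U" m n U m i j] U ij by auto
  then show ?thesis using iso ij by simp
qed

text \<open>Supplies the change of basis for one deflation step. Gram-Schmidt, applied to a basis
  starting with \<open>v\<close>, keeps \<open>v\<close> in front but yields unnormalised vectors;
  dividing by their norms \<open>sqrt (r i)\<close> produces the factor \<open>c\<close>.\<close>

lemma unitary_first_col:
  fixes v :: "complex vec"
  assumes v: "v \<in> carrier_vec n" and v0: "v \<noteq> 0\<^sub>v n" and n: "n \<noteq> 0"
  obtains U c where "unitary_mat n U" "col U 0 = c \<cdot>\<^sub>v v" 
proof -
  interpret cof_vec_space n "TYPE(complex)" .
  define b where "b = basis_completion v"
  define ws where "ws = gram_schmidt n b"
  from basis_completion[OF v v0, folded b_def]
  have dist_b: "distinct b" and indep: "\<not> lin_dep (set b)" and b: "set b \<subseteq> carrier_vec n"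
    and hdb: "hd b = v" and len_b: "length b = n" by auto
  from hdb len_b n obtain vs where bv: "b = v # vs" by (cases b, auto)
  from gram_schmidt_result[OF b dist_b indep refl, folded ws_def]
  have ws: "set ws \<subseteq> carrier_vec n" "corthogonal ws" "length ws = n" by (auto simp: len_b)
  have "hd ws = v" using gram_schmidt_hd[OF v, of vs] bv ws_def by simp
  then have ws0: "ws ! 0 = v" using ws(3) n by (cases ws) auto
  have wsc: "ws ! i \<in> carrier_vec n" if "i < n" for i using ws that by auto
  define r where "r i = Re (ws ! i \<bullet>c ws ! i)" for i
  have rr: "complex_of_real (r i) = ws ! i \<bullet>c ws ! i" "r i > 0" if "i < n" for i
  proof -
    have "ws ! i \<bullet>c ws ! i \<noteq> 0"
      using corthogonalD[OF ws(2), of i i] ws(3) that by simp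
    moreover have "ws ! i \<bullet>c ws ! i \<ge> 0" by (rule conjugate_square_ge_0_vec)
    ultimately show "complex_of_real (r i) = ws ! i \<bullet>c ws ! i" "r i > 0"
      by (auto simp: r_def less_eq_complex_def complex_eq_iff)
  qed
  define U where "U = mat n n (\<lambda>(k, i). ws ! i $ k / complex_of_real (sqrt (r i)))"
  have "unitary_mat n U"
  proof (rule unitary_cols)
    fix i j assume ij: "i < n" "j < n"
    have "(\<Sum>k<n. cnj (U $$ (k, i)) * U $$ (k, j)) 
      = (ws ! j \<bullet>c ws ! i) / (complex_of_real (sqrt (r i)) * complex_of_real (sqrt (r j)))"
      using ij wsc[of i] wsc[of j] unfolding U_def
      by (auto simp: scalar_prod_def sum_divide_distrib atLeast0LessThan ac_simps intro!: sum.cong)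
    also have "\<dots> = (if i = j then 1 else 0)"
    proof (cases "i = j")
      case True
      have "complex_of_real (sqrt (r j)) * complex_of_real (sqrt (r j)) = complex_of_real (r j)"
        using rr(2)[of j] ij by (simp flip: of_real_mult)
      then show ?thesis using True rr[of j] ij by auto
    next
      case False
      then show ?thesis using corthogonalD[OF ws(2), of j i] ws(3) ij by simp
    qed
    finally show "(\<Sum>k<n. cnj (U $$ (k, i)) * U $$ (k, j)) = (if i = j then 1 else 0)" .
  qed (simp add: U_def)
  moreover have "col U 0 = complex_of_real (1 / sqrt (r 0)) \<cdot>\<^sub>v v"
    using n v ws0 by (auto simp: U_def)
  ultimately show thesis by (rule that)
qed

lemma four_block_adjoint:
  fixes A D :: "complex mat"
  assumes "A \<in> carrier_mat m m" "D \<in> carrier_mat n n"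
  shows "mat_adjoint (four_block_mat A (0\<^sub>m m n) (0\<^sub>m n m) D)
    = four_block_mat (mat_adjoint A) (0\<^sub>m m n) (0\<^sub>m n m) (mat_adjoint D)"
  using assms by (intro eq_matI) auto

lemma four_block_diag_mult:
  fixes A D :: "complex mat"
  assumes A: "A \<in> carrier_mat m m" and A': "A' \<in> carrier_mat m m"
    and D: "D \<in> carrier_mat n n" and D': "D' \<in> carrier_mat n n"
  shows "four_block_mat A (0\<^sub>m m n) (0\<^sub>m n m) D * four_block_mat A' (0\<^sub>m m n) (0\<^sub>m n m) D'
    = four_block_mat (A * A') (0\<^sub>m m n) (0\<^sub>m n m) (D * D')"
  using mult_carrier_mat[OF A A'] mult_carrier_mat[OF D D']
  by (simp add: mult_four_block_mat[OF A zero_carrier_mat zero_carrier_mat D A' zero_carrier_mat zero_carrier_mat D']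
      left_mult_zero_mat[OF D'] left_mult_zero_mat[OF A'] right_mult_zero_mat[OF A] right_mult_zero_mat[OF D])

text \<open>Deflation: with an eigenvector as first column of \<open>U\<close>, the first column of
  \<open>U\<^sup>* A U\<close> vanishes below the corner, and hermiticity clears the first row too,
  so the induction continues with the lower block. The list \<open>es\<close> is prescribed, hence
  every ordering of the roots is realised by some unitary.\<close>

theorem hermitian_spectral:
  fixes A :: "complex mat"
  assumes "A \<in> carrier_mat n n" "mat_adjoint A = A"
    and "char_poly A = (\<Prod>e\<leftarrow>es. [:- e, 1:])"
  shows "\<exists>U. unitary_mat n U \<and> A = U * mat_diag n (\<lambda>i. es ! i) * mat_adjoint U"
  using assms
proof (induct es arbitrary: n A)
  case Nil
  with degree_monic_char_poly[of A n] have n: "n = 0" by auto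
  show ?case
    by (rule exI[of _ "1\<^sub>m 0"]) (use Nil n in \<open>auto simp: unitary_mat_def mat_diag_def\<close>)
next
  case (Cons e es n A)
  let ?m = "n - 1"
  note A = Cons(2) and adj = Cons(3)
  from Cons(4) have cp: "char_poly A = [: -e, 1 :] * (\<Prod>e \<leftarrow> es. [:- e, 1:])" by auto
  have mon: "monic (\<Prod>e\<leftarrow> es. [:- e, 1:])" by (rule monic_prod_list, auto)
  have deg: "degree (char_poly A) = Suc (degree (\<Prod>e\<leftarrow> es. [:- e, 1:]))" unfolding cp
    by (subst degree_mult_eq, insert mon, auto)
  with degree_monic_char_poly[OF A] have n: "n \<noteq> 0" by auto
  have "eigenvalue A e" unfolding eigenvalue_root_char_poly[OF A] cp by simp
  from find_eigenvector[OF A this, unfolded eigenvector_def] A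
  obtain v where v: "v \<in> carrier_vec n" "v \<noteq> 0\<^sub>v n" "A *\<^sub>v v = e \<cdot>\<^sub>v v" by auto
  obtain U c where U: "unitary_mat n U" and U0: "col U 0 = c \<cdot>\<^sub>v v"
    using unitary_first_col[OF v(1,2) n] .
  note Ud = unitary_matD[OF U]
  define B where "B = mat_adjoint U * A * U"
  have B: "B \<in> carrier_mat n n" using mult_carrier_mat[OF mult_carrier_mat[OF mat_adjoint_carrier[OF Ud(1)] A] Ud(1)] by (simp add: B_def)
  have Badj: "mat_adjoint B = B"
    using Ud A adj 
    by (simp add: B_def mat_adjoint_mult[of _ n n _ n] assoc_mult_mat[of _ n n _ n _ n] mult_carrier_mat[of _ n n _ n])
  have UBU: "U * B * mat_adjoint U = A"
  proof -
    have "U * B * mat_adjoint U = (U * mat_adjoint U) * A * (U * mat_adjoint U)"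
      using Ud(1) A unfolding B_def by (simp add: assoc_mult_mat[of _ n n _ n _ n] mult_carrier_mat[of _ n n _ n])
    then show ?thesis using Ud A by simp
  qed
  have Bcol: "B $$ (i, 0) = (if i = 0 then e else 0)" if i: "i < n" for i
  proof -
    have c: "col U 0 \<in> carrier_vec n" using Ud(1) n by (auto intro: col_carrier_vec)
    have "col B 0 = (mat_adjoint U * A) *\<^sub>v col U 0"
      unfolding B_def using n
      by (intro col_mult2[OF mult_carrier_mat[OF mat_adjoint_carrier[OF Ud(1)] A] Ud(1)]) simp
    also have "\<dots> = mat_adjoint U *\<^sub>v (A *\<^sub>v col U 0)"
      by (rule assoc_mult_mat_vec[OF mat_adjoint_carrier[OF Ud(1)] A c])
    also have "A *\<^sub>v col U 0 = e \<cdot>\<^sub>v col U 0"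
      unfolding U0 using v A mult_mat_vec[OF A v(1), of c] by (auto intro!: eq_vecI)
    also have "mat_adjoint U *\<^sub>v (e \<cdot>\<^sub>v col U 0) = e \<cdot>\<^sub>v (mat_adjoint U *\<^sub>v col U 0)"
      using Ud n by (intro mult_mat_vec[of _ n n]) auto
    also have "mat_adjoint U *\<^sub>v col U 0 = col (mat_adjoint U * U) 0"
      using n by (intro col_mult2[OF mat_adjoint_carrier[OF Ud(1)] Ud(1), symmetric]) simp
    also have "\<dots> = unit_vec n 0" using Ud n by simp
    finally have "col B 0 = e \<cdot>\<^sub>v unit_vec n 0" .
    from arg_cong[OF this, of "\<lambda>v. v $ i"] show ?thesis using B i n by auto
  qed
  have Brow: "B $$ (0, i) = (if i = 0 then e else 0)" if i: "i < n" for i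
    using Bcol[OF i] B i n Badj mat_adjoint_index[of 0 B i] Bcol[of 0]
    by (cases "i = 0") auto
  define C where "C = mat ?m ?m (\<lambda>(i, j). B $$ (Suc i, Suc j))"
  have C: "C \<in> carrier_mat ?m ?m" by (simp add: C_def)
  let ?E = "mat_diag 1 (\<lambda>_. e)"
  let ?z = "0\<^sub>m 1 ?m" and ?z' = "0\<^sub>m ?m 1"
  have E: "?E \<in> carrier_mat 1 1" by simp
  have Bblock: "B = four_block_mat ?E ?z ?z' C"
    using B n Bcol Brow by (intro eq_matI) (auto simp: C_def mat_diag_def)
  have Cadj: "mat_adjoint C = C"
  proof (rule eq_matI)
    fix i j assume ij: "i < dim_row C" "j < dim_col C"
    then have "mat_adjoint B $$ (Suc i, Suc j) = B $$ (Suc i, Suc j)" using Badj by simp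
    then show "mat_adjoint C $$ (i, j) = C $$ (i, j)" using ij B by (auto simp: C_def)
  qed (auto simp: C_def)
  have "similar_mat_wit A B U (mat_adjoint U)"
    using Ud A B UBU by (simp add: similar_mat_wit_def Let_def)
  then have "char_poly A = char_poly B" by (metis char_poly_similar similar_mat_def)
  also have "\<dots> = char_poly ?E * char_poly C"
    unfolding Bblock by (rule char_poly_four_block_zeros_col[OF E _ C]) auto
  also have "char_poly ?E = [:-e, 1:]"
    by (simp add: mat_diag_def char_poly_defs det_def sign_def)
  finally have "char_poly C = (\<Prod>e\<leftarrow>es. [:- e, 1:])" using cp
    by (metis mult_cancel_left pCons_eq_0_iff zero_neq_one)
  from Cons(1)[OF C Cadj this] obtain V where V: "unitary_mat ?m V"
    and CV: "C = V * mat_diag ?m (\<lambda>i. es ! i) * mat_adjoint V" by auto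
  note Vd = unitary_matD[OF V]
  let ?D = "mat_diag ?m (\<lambda>i. es ! i)"
  have D: "?D \<in> carrier_mat ?m ?m" by simp
  define V' where "V' = four_block_mat (1\<^sub>m 1) ?z ?z' V"
  have V'a: "mat_adjoint V' = four_block_mat (1\<^sub>m 1) ?z ?z' (mat_adjoint V)"
    unfolding V'_def using four_block_adjoint[OF one_carrier_mat Vd(1), of 1] by simp
  have n1: "1 + ?m = n" using n by simp
  have Vc: "V' \<in> carrier_mat n n" unfolding V'_def
    using four_block_carrier_mat[OF one_carrier_mat[of 1] Vd(1), of ?z ?z'] n1 by simp
  have "mat_adjoint V' * V' = four_block_mat (1\<^sub>m 1) ?z ?z' (1\<^sub>m ?m)"
    unfolding V'a unfolding V'_def
    by (subst four_block_diag_mult[OF one_carrier_mat one_carrier_mat mat_adjoint_carrier[OF Vd(1)] Vd(1)])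
      (simp add: Vd(3))
  also have "\<dots> = 1\<^sub>m n" using n by (intro eq_matI) auto
  finally have V'u: "unitary_mat n V'" by (rule unitary_matI[OF Vc])
  have Dbl: "mat_diag n (\<lambda>i. (e # es) ! i) = four_block_mat ?E ?z ?z' ?D"
    using n by (intro eq_matI) (auto simp: mat_diag_def nth_Cons')
  have "V' * mat_diag n (\<lambda>i. (e # es) ! i) = four_block_mat ?E ?z ?z' (V * ?D)"
    unfolding Dbl V'_def
    by (subst four_block_diag_mult[OF one_carrier_mat E Vd(1) D]) (simp only: left_mult_one_mat[OF E])
  then have "V' * mat_diag n (\<lambda>i. (e # es) ! i) * mat_adjoint V'
    = four_block_mat ?E ?z ?z' (V * ?D * mat_adjoint V)"
    unfolding V'a
    by (simp only: four_block_diag_mult[OF E one_carrier_mat mult_carrier_mat[OF Vd(1) D] 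
          mat_adjoint_carrier[OF Vd(1)]] right_mult_one_mat[OF E])
  also have "\<dots> = B" unfolding Bblock CV ..
  finally have BV: "B = V' * mat_diag n (\<lambda>i. (e # es) ! i) * mat_adjoint V'" ..
  have "A = (U * V') * mat_diag n (\<lambda>i. (e # es) ! i) * mat_adjoint (U * V')"
    unfolding UBU[symmetric] BV using Ud(1) Vc
    by (simp add: mat_adjoint_mult[of _ n n _ n] assoc_mult_mat[of _ n n _ n _ n] mult_carrier_mat[of _ n n _ n])
  with unitary_mat_mult[OF U V'u] show ?case by blast
qed


section \<open>Quadratic forms and traces of matrices in spectral form\<close>

lemma cscalar_prod_sum:
  fixes x y :: "complex vec"
  assumes "y \<in> carrier_vec n"
  shows "x \<bullet>c y = (\<Sum>i<n. x $ i * cnj (y $ i))"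
  using assms by (auto simp: scalar_prod_def atLeast0LessThan intro!: sum.cong)

lemma mult_mat_vec_sum:
  fixes A :: "complex mat"
  assumes "A \<in> carrier_mat m n" "x \<in> carrier_vec n" "i < m"
  shows "(A *\<^sub>v x) $ i = (\<Sum>j<n. A $$ (i, j) * x $ j)"
  using assms by (auto simp: scalar_prod_def atLeast0LessThan intro!: sum.cong)

lemma cscalar_prod_adjoint:
  fixes A :: "complex mat"
  assumes A: "A \<in> carrier_mat m n" and x: "x \<in> carrier_vec n" and y: "y \<in> carrier_vec m"
  shows "(A *\<^sub>v x) \<bullet>c y = x \<bullet>c (mat_adjoint A *\<^sub>v y)"
proof -
  have "(A *\<^sub>v x) \<bullet>c y = (\<Sum>i<m. \<Sum>j<n. A $$ (i, j) * x $ j * cnj (y $ i))"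
    by (simp add: cscalar_prod_sum[OF y] mult_mat_vec_sum[OF A x] sum_distrib_right del: index_mult_mat_vec)
  also have "\<dots> = (\<Sum>j<n. \<Sum>i<m. A $$ (i, j) * x $ j * cnj (y $ i))" by (rule sum.swap)
  also have "\<dots> = (\<Sum>j<n. x $ j * cnj (\<Sum>i<m. mat_adjoint A $$ (j, i) * y $ i))"
    using A by (intro sum.cong) (auto simp: sum_distrib_left ac_simps intro!: sum.cong)
  also have "\<dots> = x \<bullet>c (mat_adjoint A *\<^sub>v y)"
    using A y cscalar_prod_sum[of "mat_adjoint A *\<^sub>v y" n x]
    by (simp add: mult_mat_vec_sum[OF mat_adjoint_carrier[OF A] y] mult_mat_vec_carrier[of _ n m] del: index_mult_mat_vec)
  finally show ?thesis .
qed

lemma quad_form_sum: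
  fixes A :: "complex mat"
  assumes A: "A \<in> carrier_mat n n" and x: "x \<in> carrier_vec n"
  shows "(A *\<^sub>v x) \<bullet>c x = (\<Sum>i<n. \<Sum>j<n. cnj (x $ i) * A $$ (i, j) * x $ j)"
  by (simp add: cscalar_prod_sum[OF x] mult_mat_vec_sum[OF A x] sum_distrib_left ac_simps del: index_mult_mat_vec)

lemma adjoint_conj_index:
  fixes A U :: "complex mat"
  assumes A: "A \<in> carrier_mat n n" and U: "U \<in> carrier_mat n m" and k: "k < m"
  shows "(mat_adjoint U * A * U) $$ (k, k) = (A *\<^sub>v col U k) \<bullet>c col U k"
proof -
  have "(mat_adjoint U * A * U) $$ (k, k) = (mat_adjoint U * (A * U)) $$ (k, k)"
    using A U by (simp add: assoc_mult_mat[of _ m n _ n _ m])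
  also have "\<dots> = (\<Sum>i<n. cnj (U $$ (i, k)) * (\<Sum>j<n. A $$ (i, j) * U $$ (j, k)))"
    using A U k by (simp add: index_mult_mat_sum[of _ m n _ m] index_mult_mat_sum[of _ n n _ m] del: index_mult_mat)
  also have "\<dots> = (A *\<^sub>v col U k) \<bullet>c col U k"
    using A U k by (subst quad_form_sum[of _ n]) (auto simp: sum_distrib_left ac_simps intro!: sum.cong)
  finally show ?thesis .
qed

text \<open>\<open>U\<close> may be rectangular: symmetric states are decomposed by three
  orthonormal vectors in a space of dimension four.\<close>

lemma spectral_index:
  fixes U :: "complex mat"
  assumes U: "U \<in> carrier_mat n m" and "i < n" "j < n"
  shows "(U * mat_diag m d * mat_adjoint U) $$ (i, j) = (\<Sum>k<m. d k * U $$ (i, k) * cnj (U $$ (j, k)))"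
proof -
  have "(U * mat_diag m d * mat_adjoint U) $$ (i, j)
      = (\<Sum>k<m. (U * mat_diag m d) $$ (i, k) * mat_adjoint U $$ (k, j))"
    using assms by (intro index_mult_mat_sum[of _ n m _ n]) auto
  also have "\<dots> = (\<Sum>k<m. d k * U $$ (i, k) * cnj (U $$ (j, k)))"
    using assms by (intro sum.cong) (auto simp: mat_diag_mult_right[OF U])
  finally show ?thesis .
qed

lemma mat_trace_spectral:
  fixes U :: "complex mat"
  assumes U: "U \<in> carrier_mat n m" and iso: "mat_adjoint U * U = 1\<^sub>m m"
  shows "mat_trace (U * mat_diag m d * mat_adjoint U) = (\<Sum>k<m. d k)"
proof -
  have "mat_trace (U * mat_diag m d * mat_adjoint U)
      = (\<Sum>i<n. \<Sum>k<m. d k * (cnj (U $$ (i, k)) * U $$ (i, k)))"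
    using U by (auto simp: mat_trace_def spectral_index[OF U] ac_simps simp del: index_mult_mat(1) intro!: sum.cong)
  also have "\<dots> = (\<Sum>k<m. d k * (\<Sum>i<n. cnj (U $$ (i, k)) * U $$ (i, k)))"
    by (subst sum.swap) (simp add: sum_distrib_left)
  also have "\<dots> = (\<Sum>k<m. d k)" using isometry_cols[OF U iso] by (intro sum.cong) auto
  finally show ?thesis .
qed

lemma spectral_carrier:
  fixes U :: "complex mat"
  assumes "U \<in> carrier_mat n m"
  shows "U * mat_diag m d * mat_adjoint U \<in> carrier_mat n n"
  using mult_carrier_mat[OF mult_carrier_mat[OF assms mat_diag_dim] mat_adjoint_carrier[OF assms]] .

lemma spectral_adjoint:
  fixes U :: "complex mat"
  assumes U: "U \<in> carrier_mat n m"
  shows "mat_adjoint (U * mat_diag m d * mat_adjoint U) = U * mat_diag m (\<lambda>i. cnj (d i)) * mat_adjoint U"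
proof (rule eq_matI)
  note c = spectral_carrier[OF U, of d] spectral_carrier[OF U, of "\<lambda>i. cnj (d i)"]
  fix i j assume "i < dim_row (U * mat_diag m (\<lambda>i. cnj (d i)) * mat_adjoint U)" 
    "j < dim_col (U * mat_diag m (\<lambda>i. cnj (d i)) * mat_adjoint U)"
  then have ij: "i < n" "j < n" using c by auto
  show "mat_adjoint (U * mat_diag m d * mat_adjoint U) $$ (i, j) = (U * mat_diag m (\<lambda>i. cnj (d i)) * mat_adjoint U) $$ (i, j)"
    using ij c by (subst mat_adjoint_index) (auto simp: spectral_index[OF U] simp del: index_mult_mat intro!: sum.cong)
qed (use U in auto)

lemma spectral_mult:
  assumes U: "unitary_mat n U"
  shows "(U * mat_diag n d * mat_adjoint U) * (U * mat_diag n e * mat_adjoint U)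
    = U * mat_diag n (\<lambda>i. d i * e i) * mat_adjoint U"
proof -
  note Ud = unitary_matD[OF U]
  note c = mult_carrier_mat[of _ n n _ n]
  have "(U * mat_diag n d * mat_adjoint U) * (U * mat_diag n e * mat_adjoint U)
    = U * mat_diag n d * (mat_adjoint U * U) * (mat_diag n e * mat_adjoint U)"
    using Ud(1) by (simp add: assoc_mult_mat[of _ n n _ n _ n] c)
  also have "\<dots> = U * (mat_diag n d * mat_diag n e) * mat_adjoint U"
    unfolding Ud(3) using Ud(1)
    by (simp add: assoc_mult_mat[of _ n n _ n _ n] right_mult_one_mat[of _ n n] c del: mat_diag_diag)
  finally show ?thesis by simp
qed

lemma cscalar_prod_self:
  fixes x :: "complex vec"
  assumes "x \<in> carrier_vec n"
  shows "x \<bullet>c x = of_real (\<Sum>i<n. (cmod (x $ i))\<^sup>2)"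
  using assms by (simp add: cscalar_prod_sum complex_norm_square del: of_real_power)

lemma quad_form_spectral:
  fixes U :: "complex mat"
  assumes U: "U \<in> carrier_mat n m" and x: "x \<in> carrier_vec n"
  shows "((U * mat_diag m (\<lambda>i. of_real (l i)) * mat_adjoint U) *\<^sub>v x) \<bullet>c x
    = of_real (\<Sum>k<m. l k * (cmod ((mat_adjoint U *\<^sub>v x) $ k))\<^sup>2)"
proof -
  let ?D = "mat_diag m (\<lambda>i. complex_of_real (l i))" and ?y = "mat_adjoint U *\<^sub>v x"
  have y: "?y \<in> carrier_vec m" using U x by (intro mult_mat_vec_carrier[of _ m n]) auto
  have "((U * ?D * mat_adjoint U) *\<^sub>v x) \<bullet>c x = (U *\<^sub>v (?D *\<^sub>v ?y)) \<bullet>c x"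
    using U x y by (simp add: assoc_mult_mat_vec[of _ n m _ n] assoc_mult_mat_vec[of _ n m _ m] mult_carrier_mat[of _ n m _ m])
  also have "\<dots> = (?D *\<^sub>v ?y) \<bullet>c ?y"
    using U x mult_mat_vec_carrier[OF mat_diag_dim y] by (intro cscalar_prod_adjoint) auto
  also have "\<dots> = (\<Sum>i<m. of_real (l i) * (?y $ i * cnj (?y $ i)))"
    using y unfolding quad_form_sum[OF mat_diag_dim y]
    by (intro sum.cong) (auto simp: mat_diag_def if_distrib if_distribR sum.delta ac_simps cong: if_cong)
  also have "\<dots> = of_real (\<Sum>k<m. l k * (cmod (?y $ k))\<^sup>2)"
    by (simp add: complex_norm_square del: of_real_power)
  finally show ?thesis .
qed

lemma unitary_norm:
  assumes U: "unitary_mat n U" and x: "x \<in> carrier_vec n"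
  shows "(U *\<^sub>v x) \<bullet>c (U *\<^sub>v x) = x \<bullet>c x"
proof -
  note Ud = unitary_matD[OF U]
  have "(U *\<^sub>v x) \<bullet>c (U *\<^sub>v x) = x \<bullet>c (mat_adjoint U *\<^sub>v (U *\<^sub>v x))"
    using Ud x by (intro cscalar_prod_adjoint mult_mat_vec_carrier[of _ n n]) auto
  also have "mat_adjoint U *\<^sub>v (U *\<^sub>v x) = x"
    using Ud x by (simp flip: assoc_mult_mat_vec[of _ n n _ n])
  finally show ?thesis .
qed

lemma psd_spectral:
  fixes U :: "complex mat"
  assumes U: "U \<in> carrier_mat n m" and l: "\<And>i. i < m \<Longrightarrow> l i \<ge> 0"
  shows "psd_mat n (U * mat_diag m (\<lambda>i. of_real (l i)) * mat_adjoint U)"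
  unfolding psd_mat_def
proof (intro conjI ballI)
  show "U * mat_diag m (\<lambda>i. complex_of_real (l i)) * mat_adjoint U \<in> carrier_mat n n"
    by (rule spectral_carrier[OF U])
  show "mat_adjoint (U * mat_diag m (\<lambda>i. complex_of_real (l i)) * mat_adjoint U)
      = U * mat_diag m (\<lambda>i. complex_of_real (l i)) * mat_adjoint U"
    by (simp add: spectral_adjoint[OF U])
  fix v :: "complex vec" assume "v \<in> carrier_vec n"
  then show "0 \<le> ((U * mat_diag m (\<lambda>i. complex_of_real (l i)) * mat_adjoint U) *\<^sub>v v) \<bullet>c v"
    using l by (subst quad_form_spectral[OF U]) (auto simp: less_eq_complex_def intro!: sum_nonneg mult_nonneg_nonneg simp del: of_real_sum)
qed

lemma unitary_conj_cancel:
  assumes U: "unitary_mat n U" and A: "A \<in> carrier_mat n n"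
  shows "mat_adjoint U * (U * A * mat_adjoint U) * U = A"
proof -
  note Ud = unitary_matD[OF U]
  have "mat_adjoint U * (U * A * mat_adjoint U) * U = (mat_adjoint U * U) * A * (mat_adjoint U * U)"
    using Ud(1) A by (simp add: assoc_mult_mat[of _ n n _ n _ n] mult_carrier_mat[of _ n n _ n])
  then show ?thesis using Ud A by simp
qed

text \<open>The same \<open>U\<close> diagonalises \<open>A\<close> and its adjoint; undoing the
  conjugation and comparing diagonal entries shows that each eigenvalue equals its
  conjugate.\<close>

lemma hermitian_real_spectral:
  fixes A :: "complex mat"
  assumes A: "A \<in> carrier_mat n n" and adj: "mat_adjoint A = A"
  obtains U l where "unitary_mat n U" "A = U * mat_diag n (\<lambda>i. of_real (l i)) * mat_adjoint U"
proof -
  obtain es where "char_poly A = (\<Prod>e\<leftarrow>es. [:- e, 1:])" using char_poly_factorized[OF A] by auto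
  from hermitian_spectral[OF A adj this] obtain U where U: "unitary_mat n U"
    and AU: "A = U * mat_diag n (\<lambda>i. es ! i) * mat_adjoint U" by auto
  note Ud = unitary_matD[OF U]
  have "mat_diag n (\<lambda>i. cnj (es ! i)) = mat_adjoint U * mat_adjoint A * U"
    unfolding AU spectral_adjoint[OF Ud(1)] using unitary_conj_cancel[OF U mat_diag_dim] by simp
  also have "\<dots> = mat_diag n (\<lambda>i. es ! i)"
    unfolding adj unfolding AU using unitary_conj_cancel[OF U mat_diag_dim] by simp
  finally have eq: "mat_diag n (\<lambda>i. cnj (es ! i)) = mat_diag n (\<lambda>i. es ! i)" .
  have "cnj (es ! i) = es ! i" if "i < n" for i
    using arg_cong[OF eq, of "\<lambda>M. M $$ (i, i)"] that by (simp add: mat_diag_def)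
  then have "es ! i = of_real (Re (es ! i))" if "i < n" for i
    using that by (simp add: complex_eq_iff)
  then have "mat_diag n (\<lambda>i. es ! i) = mat_diag n (\<lambda>i. of_real (Re (es ! i)))"
    by (auto simp: mat_diag_def)
  then show thesis using that[OF U, of "\<lambda>i. Re (es ! i)"] AU by simp
qed

text \<open>If \<open>B\<^sup>2 = C\<^sup>2\<close> and \<open>D = B - C\<close>, then \<open>B D + D C = 0\<close>; on an eigenvector of \<open>D\<close> with eigenvalue
  \<open>l\<close> this reads \<open>l (<B> + <C>) = 0\<close>, while \<open><B> - <C> = l\<close>.\<close>

lemma psd_sqrt_unique:
  assumes B: "psd_mat n B" and C: "psd_mat n C" and sq: "B * B = C * C"
  shows "B = C"
proof -
  have Bc: "B \<in> carrier_mat n n" "mat_adjoint B = B" and Cc: "C \<in> carrier_mat n n" "mat_adjoint C = C"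
    using B C by (auto simp: psd_mat_def)
  have "mat_adjoint (B - C) = B - C"
  proof (rule eq_matI)
    fix i j assume ij: "i < dim_row (B - C)" "j < dim_col (B - C)"
    have "mat_adjoint B $$ (i, j) = B $$ (i, j)" "mat_adjoint C $$ (i, j) = C $$ (i, j)" using Bc Cc by auto
    then show "mat_adjoint (B - C) $$ (i, j) = (B - C) $$ (i, j)" using ij Bc(1) Cc(1) by auto
  qed (use Bc(1) Cc(1) in auto)
  then obtain U l where U: "unitary_mat n U" 
    and D: "B - C = U * mat_diag n (\<lambda>i. of_real (l i)) * mat_adjoint U"
    using hermitian_real_spectral[of "B - C" n] Bc(1) Cc(1) by (metis minus_carrier_mat)
  note Ud = unitary_matD[OF U]
  note c = mult_carrier_mat[of _ n n _ n]
  define B' where "B' = mat_adjoint U * B * U"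
  define C' where "C' = mat_adjoint U * C * U"
  let ?L = "mat_diag n (\<lambda>i. complex_of_real (l i))"
  have carr: "B' \<in> carrier_mat n n" "C' \<in> carrier_mat n n"
    using Ud(1) Bc Cc by (simp_all add: B'_def C'_def c)
  have L: "B' - C' = ?L"
  proof -
    have "B' - C' = mat_adjoint U * (B - C) * U"
      using Ud(1) Bc Cc by (simp add: B'_def C'_def minus_mult_distrib_mat[of _ n n _ _ n] 
          mult_minus_distrib_mat[of _ n n _ n] c)
    then show ?thesis unfolding D using unitary_conj_cancel[OF U mat_diag_dim] by simp
  qed
  have sq': "B' * B' = C' * C'"
  proof -
    have "B' * B' = mat_adjoint U * (B * (U * mat_adjoint U) * B) * U"
      using Ud(1) Bc Cc by (simp add: B'_def assoc_mult_mat[of _ n n _ n _ n] c)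
    also have "\<dots> = mat_adjoint U * (C * (U * mat_adjoint U) * C) * U"
      using Ud Bc Cc sq by simp
    also have "\<dots> = C' * C'"
      using Ud(1) Bc Cc by (simp add: C'_def assoc_mult_mat[of _ n n _ n _ n] c)
    finally show ?thesis .
  qed
  have "B' * (B' - C') + (B' - C') * C' = B' * B' - B' * C' + (B' * C' - C' * C')"
    using carr by (simp add: minus_mult_distrib_mat[of _ n n _ _ n] mult_minus_distrib_mat[of _ n n _ n])
  also have "\<dots> = 0\<^sub>m n n" unfolding sq' using carr by (intro eq_matI) auto
  finally have z: "B' * ?L + ?L * C' = 0\<^sub>m n n" unfolding L .
  have "l k = 0" if k: "k < n" for k
  proof -
    have "(B' * ?L + ?L * C') $$ (k, k) = of_real (l k) * (B' $$ (k, k) + C' $$ (k, k))"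
      using k carr by (simp add: mat_diag_mult_left[OF carr(2)] mat_diag_mult_right[OF carr(1)] algebra_simps)
    then have "of_real (l k) * (B' $$ (k, k) + C' $$ (k, k)) = 0" using z k by simp
    moreover have "B' $$ (k, k) - C' $$ (k, k) = of_real (l k)"
      using arg_cong[OF L, of "\<lambda>M. M $$ (k, k)"] k carr by (simp add: mat_diag_def)
    moreover have "0 \<le> B' $$ (k, k)" "0 \<le> C' $$ (k, k)"
      using B C k Ud(1) unfolding B'_def C'_def psd_mat_def
      by (auto simp: adjoint_conj_index[of _ n _ n] simp del: index_mult_mat)
    \<comment> \<open>If \<open>l k\<close> were nonzero, the two nonnegative diagonal entries would
      sum to 0, so both would vanish and with them their difference \<open>l k\<close>.\<close>
    ultimately show ?thesis 
      by (auto simp: less_eq_complex_def complex_eq_iff)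
  qed
  then have "?L = mat_diag n (\<lambda>i. of_real 0)" by (auto simp: mat_diag_def)
  then have "B - C = 0\<^sub>m n n" unfolding D using Ud(1)
    by (intro eq_matI) (auto simp: spectral_index[OF Ud(1)] simp del: index_mult_mat(1))
  then have d: "(B - C) $$ (i, j) = 0" if "i < n" "j < n" for i j using that by simp
  show ?thesis using d Bc Cc by (intro eq_matI) auto
qed

text \<open>Replacing each eigenvalue by its modulus gives a positive semidefinite square root of
  \<open>X\<^sup>* X\<close>; \<open>psd_sqrt_unique\<close> then evaluates the description operator
  in \<open>psd_sqrt\<close>.\<close>

lemma trace_norm_spectral:
  assumes U: "unitary_mat n U"
  shows "trace_norm (U * mat_diag n (\<lambda>i. of_real (l i)) * mat_adjoint U) = (\<Sum>k<n. \<bar>l k\<bar>)"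
proof -
  note Ud = unitary_matD[OF U]
  let ?X = "U * mat_diag n (\<lambda>i. complex_of_real (l i)) * mat_adjoint U"
  let ?Y = "U * mat_diag n (\<lambda>i. complex_of_real \<bar>l i\<bar>) * mat_adjoint U"
  have psd: "psd_mat n ?Y" by (rule psd_spectral[OF Ud(1)]) auto
  have sq: "mat_adjoint ?X * ?X = ?Y * ?Y"
    unfolding spectral_adjoint[OF Ud(1)] spectral_mult[OF U] by (simp flip: of_real_mult)
  have dim: "dim_row (?Y * ?Y) = n" using Ud by auto
  have "psd_sqrt (mat_adjoint ?X * ?X) = ?Y"
    unfolding psd_sqrt_def sq dim
    by (rule the_equality) (use psd psd_sqrt_unique in auto)
  then show ?thesis by (simp add: trace_norm_def mat_trace_spectral[OF Ud(1,3)] flip: of_real_sum)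
qed


section \<open>Negativity of two-qubit states\<close>

lemma sum_lessThan_4: "(\<Sum>k<4::nat. f k) = f 0 + f 1 + f 2 + (f 3 :: 'a::comm_monoid_add)"
  by (simp add: eval_nat_numeral ac_simps)

lemma partial_transpose_A_carrier [simp]: "partial_transpose_A \<rho> \<in> carrier_mat 4 4"
  by (simp add: partial_transpose_A_def)

lemma partial_transpose_A_adjoint:
  assumes \<rho>: "\<rho> \<in> carrier_mat 4 4" and adj: "mat_adjoint \<rho> = \<rho>"
  shows "mat_adjoint (partial_transpose_A \<rho>) = partial_transpose_A \<rho>"
proof (rule eq_matI)
  have h: "cnj (\<rho> $$ (j, i)) = \<rho> $$ (i, j)" if "i < 4" "j < 4" for i j
    using mat_adjoint_index[of i \<rho> j] adj \<rho> that by auto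
  fix i j assume "i < dim_row (partial_transpose_A \<rho>)" "j < dim_col (partial_transpose_A \<rho>)"
  then have ij: "i < 4" "j < 4" by (auto simp: partial_transpose_A_def)
  have "2 * (a div 2) + b mod 2 < 4" if "a < 4" for a b :: nat
    using that less_mult_imp_div_less[of a 2 2] mod_less_divisor[of 2 b] by linarith
  with ij show "mat_adjoint (partial_transpose_A \<rho>) $$ (i, j) = partial_transpose_A \<rho> $$ (i, j)"
    by (simp add: partial_transpose_A_def h)
qed (auto simp: partial_transpose_A_def)

lemma partial_transpose_A_trace:
  "\<rho> \<in> carrier_mat 4 4 \<Longrightarrow> mat_trace (partial_transpose_A \<rho>) = mat_trace \<rho>"
  by (auto simp: partial_transpose_A_def mat_trace_def)

text \<open>The partial transpose has trace 1, so the \<open>- 1\<close> in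
  \<open>negativity\<close> is minus the sum of the eigenvalues.\<close>

lemma negativity_spectral:
  assumes \<rho>: "\<rho> \<in> carrier_mat 4 4" and adj: "mat_adjoint \<rho> = \<rho>" and tr: "mat_trace \<rho> = 1"
  obtains U l where "unitary_mat 4 U"
    "partial_transpose_A \<rho> = U * mat_diag 4 (\<lambda>i. of_real (l i)) * mat_adjoint U"
    "negativity \<rho> = (\<Sum>k<4. \<bar>l k\<bar> - l k)"
proof -
  obtain U l where U: "unitary_mat 4 U"
    and X: "partial_transpose_A \<rho> = U * mat_diag 4 (\<lambda>i. of_real (l i)) * mat_adjoint U"
    using hermitian_real_spectral[OF partial_transpose_A_carrier partial_transpose_A_adjoint[OF \<rho> adj]] .
  have "complex_of_real (\<Sum>k<4. l k) = 1"
    using partial_transpose_A_trace[OF \<rho>] tr unfolding X mat_trace_spectral[OF unitary_matD(1,3)[OF U]] by simp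
  then have "(\<Sum>k<4. l k) = 1" using of_real_eq_1_iff by blast
  then have "negativity \<rho> = (\<Sum>k<4. \<bar>l k\<bar> - l k)"
    unfolding negativity_def X trace_norm_spectral[OF U] by (simp add: sum_subtractf)
  with U X show thesis by (rule that)
qed

lemma negativity_nonneg:
  assumes "\<rho> \<in> carrier_mat 4 4" "mat_adjoint \<rho> = \<rho>" "mat_trace \<rho> = 1"
  shows "negativity \<rho> \<ge> 0"
proof -
  obtain U l where "unitary_mat 4 U"
    and "partial_transpose_A \<rho> = U * mat_diag 4 (\<lambda>i. of_real (l i)) * mat_adjoint U"
    and N: "negativity \<rho> = (\<Sum>k<4. \<bar>l k\<bar> - l k)" using negativity_spectral[OF assms] .
  show ?thesis unfolding N by (simp add: sum_nonneg)
qed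

text \<open>Each eigenvalue satisfies \<open>- 2 * l k \<le> \<bar>l k\<bar> - l k\<close>, which is
  one summand of a nonnegative sum equal to the negativity. The test vector is left unnormalised so
  that an explicit eigenvector can be inserted directly.\<close>

lemma negativity_ge:
  assumes "\<rho> \<in> carrier_mat 4 4" "mat_adjoint \<rho> = \<rho>" "mat_trace \<rho> = 1" and x: "x \<in> carrier_vec 4"
  shows "- 2 * Re ((partial_transpose_A \<rho> *\<^sub>v x) \<bullet>c x) \<le> negativity \<rho> * Re (x \<bullet>c x)"
proof -
  obtain U l where U: "unitary_mat 4 U"
    and X: "partial_transpose_A \<rho> = U * mat_diag 4 (\<lambda>i. of_real (l i)) * mat_adjoint U"
    and N: "negativity \<rho> = (\<Sum>k<4. \<bar>l k\<bar> - l k)" using negativity_spectral[OF assms(1-3)] .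
  define y where "y = mat_adjoint U *\<^sub>v x"
  have y: "y \<in> carrier_vec 4" using unitary_matD[OF U] x by (simp add: y_def mult_mat_vec_carrier[of _ 4 4])
  have "Re (x \<bullet>c x) = Re (y \<bullet>c y)" unfolding y_def unitary_norm[OF unitary_mat_adjoint[OF U] x] ..
  also have "\<dots> = (\<Sum>k<4. (cmod (y $ k))\<^sup>2)" unfolding cscalar_prod_self[OF y] by simp
  finally have n: "Re (x \<bullet>c x) = (\<Sum>k<4. (cmod (y $ k))\<^sup>2)" .
  have "- 2 * Re ((partial_transpose_A \<rho> *\<^sub>v x) \<bullet>c x) = (\<Sum>k<4. (- 2 * l k) * (cmod (y $ k))\<^sup>2)"
    unfolding X quad_form_spectral[OF unitary_matD(1)[OF U] x] y_def[symmetric] by (simp add: sum_distrib_left mult.assoc)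
  also have "\<dots> \<le> (\<Sum>k<4. negativity \<rho> * (cmod (y $ k))\<^sup>2)"
  proof (intro sum_mono mult_right_mono)
    fix k :: nat assume "k \<in> {..<4}"
    then have "\<bar>l k\<bar> - l k \<le> negativity \<rho>" unfolding N by (intro member_le_sum) auto
    then show "- 2 * l k \<le> negativity \<rho>" by linarith
  qed auto
  also have "\<dots> = negativity \<rho> * Re (x \<bullet>c x)" by (simp add: n sum_distrib_left)
  finally show ?thesis .
qed

text \<open>Transposing the first factor conjugates the first tensor factor of a product vector.\<close>

lemma partial_transpose_A_product_vec:
  assumes \<rho>: "psd_mat 4 \<rho>" and x: "x \<in> carrier_vec 4" and d: "x $ 0 * x $ 3 = x $ 1 * x $ 2"
  shows "0 \<le> (partial_transpose_A \<rho> *\<^sub>v x) \<bullet>c x"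
proof -
  \<comment> \<open>The hypothesis \<open>d\<close> says that the 2 by 2 coefficient matrix of
    \<open>x\<close> has determinant 0, so it has rank at most one and \<open>x\<close> is a product
    vector.\<close>
  have "\<exists>a0 a1 b0 b1. x $ 0 = a0 * b0 \<and> x $ 1 = a0 * b1 \<and> x $ 2 = a1 * b0 \<and> x $ 3 = a1 * b1"
  proof -
    consider "x $ 0 \<noteq> 0" | "x $ 0 = 0" "x $ 1 = 0" | "x $ 0 = 0" "x $ 2 = 0" using d by (cases "x $ 0 = 0") auto
    then show ?thesis
    proof cases
      case 1
      then have "x $ 3 = x $ 2 / x $ 0 * x $ 1" using d by (simp add: field_simps)
      with 1 show ?thesis
        by (intro exI[of _ 1] exI[of _ "x $ 2 / x $ 0"] exI[of _ "x $ 0"] exI[of _ "x $ 1"]) simp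
    next
      case 2
      then show ?thesis by (intro exI[of _ 0] exI[of _ 1] exI[of _ "x $ 2"] exI[of _ "x $ 3"]) simp
    next
      case 3
      then show ?thesis by (intro exI[of _ "x $ 1"] exI[of _ "x $ 3"] exI[of _ 0] exI[of _ 1]) simp
    qed
  qed
  then obtain a0 a1 b0 b1 where ab: "x $ 0 = a0 * b0" "x $ 1 = a0 * b1" "x $ 2 = a1 * b0" "x $ 3 = a1 * b1"
    by blast
  define y where "y = vec 4 (\<lambda>i. [cnj a0 * b0, cnj a0 * b1, cnj a1 * b0, cnj a1 * b1] ! i)"
  have y: "y \<in> carrier_vec 4" by (simp add: y_def)
  have yi: "y $ 0 = cnj a0 * b0" "y $ Suc 0 = cnj a0 * b1" "y $ 2 = cnj a1 * b0" "y $ 3 = cnj a1 * b1"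
    by (simp_all add: y_def)
  have "\<rho> \<in> carrier_mat 4 4" using \<rho> by (simp add: psd_mat_def)
  then have "(partial_transpose_A \<rho> *\<^sub>v x) \<bullet>c x = (\<rho> *\<^sub>v y) \<bullet>c y"
    using ab unfolding quad_form_sum[OF partial_transpose_A_carrier x] quad_form_sum[OF \<open>\<rho> \<in> carrier_mat 4 4\<close> y]
    by (simp add: sum_lessThan_4 yi partial_transpose_A_def algebra_simps flip: numeral_2_eq_2)
  then show ?thesis using \<rho> y by (simp add: psd_mat_def)
qed

text \<open>For t = 1 the determinant of \<open>s * a + t * b\<close>, read as 2 by 2 matrices, is a
  polynomial in \<open>s\<close> with leading coefficient det a. If det a is nonzero, the quadratic
  formula gives a complex root; otherwise \<open>a\<close> itself is singular.\<close>

lemma exists_singular_combination: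
  fixes a0 a1 a2 a3 b0 b1 b2 b3 :: complex
  obtains s t where "s \<noteq> 0 \<or> t \<noteq> 0"
    "(s * a0 + t * b0) * (s * a3 + t * b3) = (s * a1 + t * b1) * (s * a2 + t * b2)"
proof (cases "a0 * a3 = a1 * a2")
  case True
  then show thesis by (intro that[of 1 0]) auto
next
  case False
  define A where "A = a0 * a3 - a1 * a2"
  define B where "B = a0 * b3 + b0 * a3 - a1 * b2 - b1 * a2"
  define C where "C = b0 * b3 - b1 * b2"
  have A: "A \<noteq> 0" using False by (simp add: A_def)
  define r where "r = csqrt (B\<^sup>2 - 4 * A * C)"
  have r: "r * r = B * B - 4 * A * C" unfolding r_def by (metis power2_csqrt power2_eq_square)
  define s where "s = (r - B) / (2 * A)"
  have s: "2 * A * s = r - B" using A by (simp add: s_def)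
  have "4 * A * (A * s * s + B * s + C) = (2 * A * s) * (2 * A * s) + 2 * B * (2 * A * s) + 4 * A * C"
    by (simp add: algebra_simps)
  also have "\<dots> = 0" unfolding s using r by (simp add: algebra_simps)
  finally have "A * s * s + B * s + C = 0" using A by simp
  then have "(s * a0 + 1 * b0) * (s * a3 + 1 * b3) = (s * a1 + 1 * b1) * (s * a2 + 1 * b2)"
    by (simp add: A_def B_def C_def algebra_simps)
  then show thesis by (intro that[of s 1]) auto
qed

text \<open>Two negative eigenvalues would make the quadratic form negative definite on a plane, but
  every plane in the two-qubit space contains a product vector.\<close>

lemma partial_transpose_A_one_negative:
  assumes \<rho>: "psd_mat 4 \<rho>" and U: "unitary_mat 4 U"
    and X: "partial_transpose_A \<rho> = U * mat_diag 4 (\<lambda>i. of_real (l i)) * mat_adjoint U"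
    and jk: "j < 4" "k < 4" "j \<noteq> k" and neg: "l j < 0" "l k < 0"
  shows False
proof -
  note Ud = unitary_matD[OF U]
  obtain s t where st: "s \<noteq> 0 \<or> t \<noteq> 0"
    "(s * U $$ (0, j) + t * U $$ (0, k)) * (s * U $$ (3, j) + t * U $$ (3, k))
      = (s * U $$ (1, j) + t * U $$ (1, k)) * (s * U $$ (2, j) + t * U $$ (2, k))"
    by (rule exists_singular_combination)
  \<comment> \<open>The coordinates of \<open>x\<close> in the eigenbasis \<open>U\<close>: only the
    two negative directions occur, with the coefficients that make \<open>x\<close> a product
    vector.\<close>
  define w where "w = vec 4 (\<lambda>i. if i = j then s else if i = k then t else 0)"
  have w: "w \<in> carrier_vec 4" by (simp add: w_def)
  define x where "x = U *\<^sub>v w"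
  have x: "x \<in> carrier_vec 4" using Ud w by (auto simp: x_def intro: mult_mat_vec_carrier)
  have xi: "x $ i = s * U $$ (i, j) + t * U $$ (i, k)" if "i < 4" for i
  proof -
    have "x $ i = (\<Sum>m<4. (if m = j then s * U $$ (i, j) else 0) + (if m = k then t * U $$ (i, k) else 0))"
      unfolding x_def mult_mat_vec_sum[OF Ud(1) w that] using jk by (intro sum.cong) (auto simp: w_def)
    then show ?thesis using jk by (simp add: sum.distrib)
  qed
  have "mat_adjoint U *\<^sub>v x = w" unfolding x_def using Ud w by (simp flip: assoc_mult_mat_vec[of _ 4 4 _ 4])
  then have "(partial_transpose_A \<rho> *\<^sub>v x) \<bullet>c x = of_real (\<Sum>m<4. l m * (cmod (w $ m))\<^sup>2)"
    unfolding X quad_form_spectral[OF unitary_matD(1)[OF U] x] by simp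
  also have "(\<Sum>m<4. l m * (cmod (w $ m))\<^sup>2)
      = (\<Sum>m<4. (if m = j then l j * (cmod s)\<^sup>2 else 0) + (if m = k then l k * (cmod t)\<^sup>2 else 0))"
    using jk by (intro sum.cong) (auto simp: w_def)
  also have "\<dots> = l j * (cmod s)\<^sup>2 + l k * (cmod t)\<^sup>2" using jk by (simp add: sum.distrib)
  finally have "0 \<le> l j * (cmod s)\<^sup>2 + l k * (cmod t)\<^sup>2"
    using partial_transpose_A_product_vec[OF \<rho> x] st(2) by (simp add: xi less_eq_complex_def)
  moreover have "l j * (cmod s)\<^sup>2 \<le> 0" "l k * (cmod t)\<^sup>2 \<le> 0" 
    using neg by (auto simp: mult_nonpos_nonneg)
  moreover have "l j * (cmod s)\<^sup>2 < 0 \<or> l k * (cmod t)\<^sup>2 < 0"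
    using neg st(1) by (auto simp: mult_neg_pos)
  ultimately show False by linarith
qed

text \<open>The quadratic form bound alone would allow several eigenvalues near \<open>- b\<close>.
  As at most one is negative, the negativity is either 0 or \<open>- 2 * l k\<close>, and the bound
  is evaluated at the eigenvector of that \<open>l k\<close>.\<close>

lemma negativity_le:
  assumes \<rho>: "density_mat 4 \<rho>" and b: "b \<ge> 0"
    and bound: "\<And>x. x \<in> carrier_vec 4 \<Longrightarrow> - b * Re (x \<bullet>c x) \<le> Re ((partial_transpose_A \<rho> *\<^sub>v x) \<bullet>c x)"
  shows "negativity \<rho> \<le> 2 * b"
proof -
  have psd: "psd_mat 4 \<rho>" and h: "\<rho> \<in> carrier_mat 4 4" "mat_adjoint \<rho> = \<rho>" "mat_trace \<rho> = 1"
    using \<rho> by (auto simp: density_mat_def psd_mat_def)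
  obtain U l where U: "unitary_mat 4 U"
    and X: "partial_transpose_A \<rho> = U * mat_diag 4 (\<lambda>i. of_real (l i)) * mat_adjoint U"
    and N: "negativity \<rho> = (\<Sum>k<4. \<bar>l k\<bar> - l k)" using negativity_spectral[OF h] .
  note Ud = unitary_matD[OF U]
  show ?thesis
  proof (cases "\<exists>k<4. l k < 0")
    case False
    then have "l k \<ge> 0" if "k < 4" for k using that by force
    then have "negativity \<rho> = 0" unfolding N by (intro sum.neutral) auto
    then show ?thesis using b by simp
  next
    case True
    then obtain k where k: "k < 4" "l k < 0" by auto
    have "\<bar>l j\<bar> - l j = (if j = k then - 2 * l k else 0)" if "j < 4" for j
      using partial_transpose_A_one_negative[OF psd U X that k(1)] k(2) by fastforce
    then have Nk: "negativity \<rho> = - 2 * l k" unfolding N using k(1) by simp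
    have ev: "unit_vec 4 k \<in> carrier_vec 4" by simp
    define x where "x = U *\<^sub>v unit_vec 4 k"
    have x: "x \<in> carrier_vec 4" using Ud by (auto simp: x_def intro: mult_mat_vec_carrier)
    have "mat_adjoint U *\<^sub>v x = unit_vec 4 k" unfolding x_def using Ud by (simp flip: assoc_mult_mat_vec[of _ 4 4 _ 4])
    then have "(partial_transpose_A \<rho> *\<^sub>v x) \<bullet>c x = of_real (\<Sum>m<4. l m * (cmod (unit_vec 4 k $ m))\<^sup>2)"
      unfolding X quad_form_spectral[OF unitary_matD(1)[OF U] x] by simp
    also have "(\<Sum>m<4. l m * (cmod (unit_vec 4 k $ m))\<^sup>2) = (\<Sum>m<4. if m = k then l k else 0)"
      using k by (intro sum.cong) auto
    finally have "Re ((partial_transpose_A \<rho> *\<^sub>v x) \<bullet>c x) = l k" using k by simp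
    moreover have "x \<bullet>c x = 1"
    proof -
      have "(\<Sum>m<4. (cmod (unit_vec 4 k $ m))\<^sup>2) = (\<Sum>m<4. if m = k then 1 else 0)"
        using k by (intro sum.cong) auto
      then show ?thesis unfolding x_def unitary_norm[OF U ev] cscalar_prod_self[OF ev] using k by simp
    qed
    ultimately show ?thesis using bound[OF x] Nk by simp
  qed
qed


section \<open>The quadratic form of the partial transpose of a symmetric state\<close>

text \<open>\<open><w|M|w>\<close> for the matrix \<open>M = t t\<^sup>T - i c [t]\<close>, with \<open>[t]\<close> the matrix of the cross product with
  \<open>t\<close>: writing \<open>w = u + i v\<close>, it is \<open>|t \<bullet> w|\<^sup>2 - 2 c t \<bullet> (u \<times> v)\<close>.\<close>

definition bloch_form :: "real \<Rightarrow> real \<Rightarrow> real \<Rightarrow> real \<Rightarrow> complex \<Rightarrow> complex \<Rightarrow> complex \<Rightarrow> real" where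
  "bloch_form c t1 t2 t3 w1 w2 w3 =
     (t1 * Re w1 + t2 * Re w2 + t3 * Re w3)\<^sup>2 + (t1 * Im w1 + t2 * Im w2 + t3 * Im w3)\<^sup>2
     - 2 * c * (t1 * (Re w2 * Im w3 - Re w3 * Im w2) + t2 * (Re w3 * Im w1 - Re w1 * Im w3)
       + t3 * (Re w1 * Im w2 - Re w2 * Im w1))"

text \<open>Lagrange's identity turns the squared cross product into |p|^2 |r|^2 - (p . r)^2; the
  rest is the inequality of arithmetic and geometric means for |p|^2 and |r|^2.\<close>

lemma lagrange_cross_le:
  fixes p1 p2 p3 r1 r2 r3 :: real
  shows "4 * ((p2 * r3 - p3 * r2)\<^sup>2 + (p3 * r1 - p1 * r3)\<^sup>2 + (p1 * r2 - p2 * r1)\<^sup>2)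
    \<le> (p1\<^sup>2 + p2\<^sup>2 + p3\<^sup>2 + (r1\<^sup>2 + r2\<^sup>2 + r3\<^sup>2))\<^sup>2"
proof -
  have "(p1\<^sup>2 + p2\<^sup>2 + p3\<^sup>2 + (r1\<^sup>2 + r2\<^sup>2 + r3\<^sup>2))\<^sup>2
      - 4 * ((p2 * r3 - p3 * r2)\<^sup>2 + (p3 * r1 - p1 * r3)\<^sup>2 + (p1 * r2 - p2 * r1)\<^sup>2)
    = (p1\<^sup>2 + p2\<^sup>2 + p3\<^sup>2 - (r1\<^sup>2 + r2\<^sup>2 + r3\<^sup>2))\<^sup>2 + 4 * (p1 * r1 + p2 * r2 + p3 * r3)\<^sup>2"
    by (simp add: power2_eq_square algebra_simps)
  moreover have "0 \<le> (p1\<^sup>2 + p2\<^sup>2 + p3\<^sup>2 - (r1\<^sup>2 + r2\<^sup>2 + r3\<^sup>2))\<^sup>2 + 4 * (p1 * r1 + p2 * r2 + p3 * r3)\<^sup>2"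
    by simp
  ultimately show ?thesis by linarith
qed

text \<open>Put p = t x u and r = t x v. Then p x r = d t, while |p|^2 + |r|^2 = T N - q, so the
  claim is \<open>lagrange_cross_le\<close> for this pair.\<close>

lemma triple_product_le:
  fixes t1 t2 t3 u1 u2 u3 v1 v2 v3 :: real
  defines "T \<equiv> t1\<^sup>2 + t2\<^sup>2 + t3\<^sup>2"
    and "d \<equiv> t1 * (u2 * v3 - u3 * v2) + t2 * (u3 * v1 - u1 * v3) + t3 * (u1 * v2 - u2 * v1)"
    and "q \<equiv> (t1 * u1 + t2 * u2 + t3 * u3)\<^sup>2 + (t1 * v1 + t2 * v2 + t3 * v3)\<^sup>2"
    and "N \<equiv> u1\<^sup>2 + u2\<^sup>2 + u3\<^sup>2 + (v1\<^sup>2 + v2\<^sup>2 + v3\<^sup>2)"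
  shows "2 * sqrt T * \<bar>d\<bar> \<le> T * N - q"
proof -
  define p1 where "p1 = t2 * u3 - t3 * u2"
  define p2 where "p2 = t3 * u1 - t1 * u3"
  define p3 where "p3 = t1 * u2 - t2 * u1"
  define r1 where "r1 = t2 * v3 - t3 * v2"
  define r2 where "r2 = t3 * v1 - t1 * v3"
  define r3 where "r3 = t1 * v2 - t2 * v1"
  have T: "T \<ge> 0" by (simp add: T_def)
  have sum: "p1\<^sup>2 + p2\<^sup>2 + p3\<^sup>2 + (r1\<^sup>2 + r2\<^sup>2 + r3\<^sup>2) = T * N - q"
    unfolding p1_def p2_def p3_def r1_def r2_def r3_def T_def N_def q_def
    by (simp add: power2_eq_square algebra_simps)
  have "p2 * r3 - p3 * r2 = t1 * d" "p3 * r1 - p1 * r3 = t2 * d" "p1 * r2 - p2 * r1 = t3 * d"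
    unfolding p1_def p2_def p3_def r1_def r2_def r3_def d_def
    by (simp_all add: algebra_simps)
  then have "4 * ((t1 * d)\<^sup>2 + (t2 * d)\<^sup>2 + (t3 * d)\<^sup>2) \<le> (T * N - q)\<^sup>2"
    using lagrange_cross_le[of p2 r3 p3 r2 r1 p1] unfolding sum by simp
  moreover have "4 * ((t1 * d)\<^sup>2 + (t2 * d)\<^sup>2 + (t3 * d)\<^sup>2) = 4 * T * d\<^sup>2"
    unfolding T_def by (simp add: power_mult_distrib algebra_simps)
  moreover have "(2 * sqrt T * \<bar>d\<bar>)\<^sup>2 = 4 * T * d\<^sup>2"
    using T by (simp add: power_mult_distrib)
  moreover have "0 \<le> p1\<^sup>2 + p2\<^sup>2 + p3\<^sup>2 + (r1\<^sup>2 + r2\<^sup>2 + r3\<^sup>2)" by simp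
  ultimately have "(2 * sqrt T * \<bar>d\<bar>)\<^sup>2 \<le> (T * N - q)\<^sup>2" "0 \<le> T * N - q" unfolding sum by linarith+
  then show ?thesis by (rule power2_le_imp_le)
qed

text \<open>The bounds are the extreme eigenvalues of the matrix of \<open>bloch_form\<close>,
  obtained without diagonalising it: the triple product is controlled by what the projection
  \<open>q\<close> onto t leaves of the norm.\<close>

lemma bloch_form_bounds:
  fixes c t1 t2 t3 :: real
  defines "s \<equiv> sqrt (t1\<^sup>2 + t2\<^sup>2 + t3\<^sup>2)"
  assumes N: "(cmod w1)\<^sup>2 + (cmod w2)\<^sup>2 + (cmod w3)\<^sup>2 = N"
  shows "- (N * (\<bar>c\<bar> * s)) \<le> bloch_form c t1 t2 t3 w1 w2 w3"
    and "bloch_form c t1 t2 t3 w1 w2 w3 \<le> N * max (s\<^sup>2) (\<bar>c\<bar> * s)"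
proof -
  define q where "q = (t1 * Re w1 + t2 * Re w2 + t3 * Re w3)\<^sup>2 + (t1 * Im w1 + t2 * Im w2 + t3 * Im w3)\<^sup>2"
  define d where "d = t1 * (Re w2 * Im w3 - Re w3 * Im w2) + t2 * (Re w3 * Im w1 - Re w1 * Im w3)
       + t3 * (Re w1 * Im w2 - Re w2 * Im w1)"
  have m: "bloch_form c t1 t2 t3 w1 w2 w3 = q - 2 * c * d"
    by (simp add: bloch_form_def q_def d_def)
  have s2: "s\<^sup>2 = t1\<^sup>2 + t2\<^sup>2 + t3\<^sup>2" and s0: "s \<ge> 0" by (simp_all add: s_def)
  have q0: "q \<ge> 0" by (simp add: q_def)
  have N0: "N \<ge> 0" using N by (metis add_nonneg_nonneg zero_le_power2)
  have td: "2 * s * \<bar>d\<bar> \<le> s\<^sup>2 * N - q"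
  proof -
    have N': "N = (Re w1)\<^sup>2 + (Re w2)\<^sup>2 + (Re w3)\<^sup>2 + ((Im w1)\<^sup>2 + (Im w2)\<^sup>2 + (Im w3)\<^sup>2)"
      using N by (simp add: cmod_power2)
    show ?thesis unfolding s2 N' unfolding s_def d_def q_def by (rule triple_product_le)
  qed
  have "- (N * (\<bar>c\<bar> * s)) \<le> q - 2 * c * d \<and> q - 2 * c * d \<le> N * max (s\<^sup>2) (\<bar>c\<bar> * s)"
  proof (cases "s = 0")
    case True
    then have "t1 = 0" "t2 = 0" "t3 = 0" using s2 by (auto simp: add_nonneg_eq_0_iff)
    then show ?thesis using True N0 by (simp add: q_def d_def)
  next
    case False
    then have s: "s > 0" using s0 by simp
    have qs: "q \<le> s\<^sup>2 * N" using td s by (smt (verit) abs_ge_zero mult_nonneg_nonneg)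
    \<comment> \<open>The factor that converts the bound on 2 s |d| into one on |2 c d|.\<close>
    define r where "r = \<bar>c\<bar> / s"
    have r: "r \<ge> 0" "r * s = \<bar>c\<bar>" using s by (auto simp: r_def)
    have "\<bar>2 * c * d\<bar> = r * (2 * s * \<bar>d\<bar>)"
      unfolding abs_mult r(2)[symmetric] by simp
    also have "\<dots> \<le> r * (s\<^sup>2 * N - q)" using td r by (intro mult_left_mono)
    finally have cd: "\<bar>2 * c * d\<bar> \<le> r * (s\<^sup>2 * N - q)" .
    have rs: "r * s\<^sup>2 = \<bar>c\<bar> * s" using r(2) by (simp add: power2_eq_square flip: mult.assoc)
    have cd': "r * (s\<^sup>2 * N - q) = N * (\<bar>c\<bar> * s) - r * q"
      unfolding rs[symmetric] by (simp add: algebra_simps)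
    have rq: "r * q \<ge> 0" using r q0 by simp
    have lo: "- (N * (\<bar>c\<bar> * s)) \<le> q - 2 * c * d" using cd cd' rq q0 by linarith
    \<comment> \<open>The left side is affine in \<open>q\<close> on the interval from 0 to s^2 N,
      with end values |c| s N and s^2 N; the slope 1 - r decides which end is larger.\<close>
    have "q + r * (s\<^sup>2 * N - q) \<le> N * max (s\<^sup>2) (\<bar>c\<bar> * s)"
    proof (cases "r \<le> 1")
      case True
      then have "r * (s\<^sup>2 * N - q) \<le> 1 * (s\<^sup>2 * N - q)" using qs by (intro mult_right_mono) auto
      then have "q + r * (s\<^sup>2 * N - q) \<le> N * s\<^sup>2" by (simp add: algebra_simps)
      also have "\<dots> \<le> N * max (s\<^sup>2) (\<bar>c\<bar> * s)" using N0 by (intro mult_left_mono) auto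
      finally show ?thesis .
    next
      case False
      then have "1 * q \<le> r * q" using q0 by (intro mult_right_mono) auto
      then have "q + r * (s\<^sup>2 * N - q) \<le> N * (\<bar>c\<bar> * s)" unfolding cd' by simp
      also have "\<dots> \<le> N * max (s\<^sup>2) (\<bar>c\<bar> * s)" using N0 by (intro mult_left_mono) auto
      finally show ?thesis .
    qed
    with lo cd show ?thesis by linarith
  qed
  then show "- (N * (\<bar>c\<bar> * s)) \<le> bloch_form c t1 t2 t3 w1 w2 w3"
    "bloch_form c t1 t2 t3 w1 w2 w3 \<le> N * max (s\<^sup>2) (\<bar>c\<bar> * s)" unfolding m by auto
qed

text \<open>Abel summation reduces the weighted sum to bounds on \<open>m1\<close> and on \<open>m1 + m2 = s\<^sup>2 - m3\<close>.\<close>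

lemma weighted_sum_le:
  fixes \<tau>1 \<tau>2 \<tau>3 c s m1 m2 m3 :: real
  assumes \<tau>: "\<tau>1 \<ge> \<tau>2" "\<tau>2 \<ge> \<tau>3" "\<tau>3 \<ge> 0" and cs: "c \<ge> 0" "s \<ge> 0"
    and m1: "m1 \<le> max (s\<^sup>2) (c * s)" and m3: "- (c * s) \<le> m3" and m: "m1 + m2 + m3 = s\<^sup>2"
  shows "2 * (\<tau>1 * m1 + \<tau>2 * m2 + \<tau>3 * m3) \<le> (\<tau>1 + sqrt (\<tau>1\<^sup>2 + (\<tau>2 - \<tau>3)\<^sup>2)) * (c\<^sup>2 + s\<^sup>2)"
proof -
  define R where "R = sqrt (\<tau>1\<^sup>2 + (\<tau>2 - \<tau>3)\<^sup>2)"
  have "\<tau>1 * m1 + \<tau>2 * m2 + \<tau>3 * m3 = (\<tau>1 - \<tau>2) * m1 + (\<tau>2 - \<tau>3) * (m1 + m2) + \<tau>3 * (m1 + m2 + m3)"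
    by (simp add: algebra_simps)
  also have "\<dots> \<le> (\<tau>1 - \<tau>2) * max (s\<^sup>2) (c * s) + (\<tau>2 - \<tau>3) * (s\<^sup>2 + c * s) + \<tau>3 * s\<^sup>2"
  proof -
    have "(\<tau>1 - \<tau>2) * m1 \<le> (\<tau>1 - \<tau>2) * max (s\<^sup>2) (c * s)" using \<tau> m1 by (intro mult_left_mono) auto
    moreover have "(\<tau>2 - \<tau>3) * (m1 + m2) \<le> (\<tau>2 - \<tau>3) * (s\<^sup>2 + c * s)"
      using \<tau> m3 m by (intro mult_left_mono) auto
    ultimately show ?thesis unfolding m by linarith
  qed
  finally have le: "\<tau>1 * m1 + \<tau>2 * m2 + \<tau>3 * m3
    \<le> (\<tau>1 - \<tau>2) * max (s\<^sup>2) (c * s) + (\<tau>2 - \<tau>3) * (s\<^sup>2 + c * s) + \<tau>3 * s\<^sup>2" .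
  show ?thesis
  proof (cases "c \<le> s")
    case True
    then have "max (s\<^sup>2) (c * s) = s\<^sup>2" using cs by (simp add: power2_eq_square mult_right_mono max_absorb1)
    then have le': "2 * (\<tau>1 * m1 + \<tau>2 * m2 + \<tau>3 * m3) \<le> \<tau>1 * (c\<^sup>2 + s\<^sup>2) + (\<tau>1 * (s\<^sup>2 - c\<^sup>2) + (\<tau>2 - \<tau>3) * (2 * c * s))"
      using le by (simp add: algebra_simps)
    \<comment> \<open>Cauchy-Schwarz for (\<tau>1, \<tau>2 - \<tau>3) and the double-angle vector
      (s^2 - c^2, 2 c s), whose length is c^2 + s^2. The second square is the defect.\<close>
    have "(\<tau>1 * (s\<^sup>2 - c\<^sup>2) + (\<tau>2 - \<tau>3) * (2 * c * s))\<^sup>2 + (\<tau>1 * (2 * c * s) - (\<tau>2 - \<tau>3) * (s\<^sup>2 - c\<^sup>2))\<^sup>2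
      = (\<tau>1\<^sup>2 + (\<tau>2 - \<tau>3)\<^sup>2) * (c\<^sup>2 + s\<^sup>2)\<^sup>2"
      by (simp add: power2_eq_square algebra_simps)
    also have "\<dots> = (R * (c\<^sup>2 + s\<^sup>2))\<^sup>2" by (simp add: R_def power_mult_distrib)
    finally have "(\<tau>1 * (s\<^sup>2 - c\<^sup>2) + (\<tau>2 - \<tau>3) * (2 * c * s))\<^sup>2 \<le> (R * (c\<^sup>2 + s\<^sup>2))\<^sup>2"
      by (smt (verit) zero_le_power2)
    moreover have "R * (c\<^sup>2 + s\<^sup>2) \<ge> 0" unfolding R_def by (intro mult_nonneg_nonneg) auto
    ultimately have "\<tau>1 * (s\<^sup>2 - c\<^sup>2) + (\<tau>2 - \<tau>3) * (2 * c * s) \<le> R * (c\<^sup>2 + s\<^sup>2)"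
      by (rule power2_le_imp_le)
    with le' show ?thesis unfolding R_def[symmetric] by (simp add: algebra_simps)
  next
    case False
    then have sc: "s \<le> c" by simp
    have "max (s\<^sup>2) (c * s) = c * s" using cs sc by (simp add: power2_eq_square mult_right_mono max_absorb2)
    then have le': "2 * (\<tau>1 * m1 + \<tau>2 * m2 + \<tau>3 * m3) \<le> (\<tau>1 - \<tau>3) * (2 * c * s) + \<tau>2 * (2 * s\<^sup>2)"
      using le by (simp add: algebra_simps)
    \<comment> \<open>For c > s no optimisation over the angle is needed: the crude estimates give
      \<tau>1 + \<tau>2 - \<tau>3, and R is at least \<tau>2 - \<tau>3.\<close>
    also have "\<dots> \<le> (\<tau>1 - \<tau>3) * (c\<^sup>2 + s\<^sup>2) + \<tau>2 * (c\<^sup>2 + s\<^sup>2)"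
    proof (intro add_mono mult_left_mono)
      show "2 * c * s \<le> c\<^sup>2 + s\<^sup>2" by (rule sum_squares_bound)
      show "2 * s\<^sup>2 \<le> c\<^sup>2 + s\<^sup>2" using power_mono[OF sc cs(2), of 2] by simp
    qed (use \<tau> in auto)
    also have "\<dots> = (\<tau>1 + (\<tau>2 - \<tau>3)) * (c\<^sup>2 + s\<^sup>2)" by (simp add: algebra_simps)
    also have "\<dots> \<le> (\<tau>1 + R) * (c\<^sup>2 + s\<^sup>2)"
      unfolding R_def by (intro mult_right_mono add_left_mono real_le_rsqrt) auto
    finally show ?thesis unfolding R_def .
  qed
qed

text \<open>The four expressions inside \<open>cmod\<close> are the Pauli coordinates of (c + t .
  sigma)(w . sigma) = t . w + (c w + i t x w) . sigma. The identity follows from |t x w|^2 + |t .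
  w|^2 = |t|^2 |w|^2 for real t.\<close>

lemma bloch_form_real:
  fixes c t1 t2 t3 :: real and w1 w2 w3 :: complex
  shows "(cmod (c * w1 + \<i> * (t2 * w3 - t3 * w2)))\<^sup>2 + (cmod (c * w2 + \<i> * (t3 * w1 - t1 * w3)))\<^sup>2
    + (cmod (c * w3 + \<i> * (t1 * w2 - t2 * w1)))\<^sup>2 - (cmod (t1 * w1 + t2 * w2 + t3 * w3))\<^sup>2
    = (c\<^sup>2 + t1\<^sup>2 + t2\<^sup>2 + t3\<^sup>2) * ((cmod w1)\<^sup>2 + (cmod w2)\<^sup>2 + (cmod w3)\<^sup>2) - 2 * bloch_form c t1 t2 t3 w1 w2 w3"
  unfolding bloch_form_def cmod_power2
  by (simp add: power2_eq_square algebra_simps)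

text \<open>The sesquilinear form behind the left side of \<open>bloch_form_real\<close> takes real
  values on pairs of real coordinate vectors; this is the vanishing of the cross terms between
  \<open>Re z\<close> and \<open>Im z\<close>.\<close>

lemma bloch_form_cross:
  fixes c t1 t2 t3 c' t1' t2' t3' :: real and w1 w2 w3 :: complex
  shows "Im (cnj (c * w1 + \<i> * (t2 * w3 - t3 * w2)) * (c' * w1 + \<i> * (t2' * w3 - t3' * w2)))
    + Im (cnj (c * w2 + \<i> * (t3 * w1 - t1 * w3)) * (c' * w2 + \<i> * (t3' * w1 - t1' * w3)))
    + Im (cnj (c * w3 + \<i> * (t1 * w2 - t2 * w1)) * (c' * w3 + \<i> * (t1' * w2 - t2' * w1)))
    = Im (cnj (t1 * w1 + t2 * w2 + t3 * w3) * (t1' * w1 + t2' * w2 + t3' * w3))"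
  by (simp add: algebra_simps)

lemma cmod_add_ii_mult:
  "(cmod (a + \<i> * b))\<^sup>2 = (cmod a)\<^sup>2 + (cmod b)\<^sup>2 - 2 * Im (cnj a * b)"
  unfolding cmod_power2 by (simp add: power2_eq_square algebra_simps)

text \<open>All four expressions are complex linear in z, so each is its value at
  \<open>Re z\<close> plus \<open>\<i>\<close> times its value at \<open>Im z\<close>. Expanding the
  moduli leaves two instances of \<open>bloch_form_real\<close> and the cross terms of
  \<open>bloch_form_cross\<close>.\<close>

lemma bloch_form_complex:
  fixes z0 z1 z2 z3 w1 w2 w3 :: complex
  shows "(cmod (z0 * w1 + \<i> * (z2 * w3 - z3 * w2)))\<^sup>2 + (cmod (z0 * w2 + \<i> * (z3 * w1 - z1 * w3)))\<^sup>2
    + (cmod (z0 * w3 + \<i> * (z1 * w2 - z2 * w1)))\<^sup>2 - (cmod (z1 * w1 + z2 * w2 + z3 * w3))\<^sup>2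
    = ((cmod z0)\<^sup>2 + (cmod z1)\<^sup>2 + (cmod z2)\<^sup>2 + (cmod z3)\<^sup>2) * ((cmod w1)\<^sup>2 + (cmod w2)\<^sup>2 + (cmod w3)\<^sup>2)
      - 2 * bloch_form (Re z0) (Re z1) (Re z2) (Re z3) w1 w2 w3
      - 2 * bloch_form (Im z0) (Im z1) (Im z2) (Im z3) w1 w2 w3"
proof -
  have z: "z = of_real (Re z) + \<i> * of_real (Im z)" for z by (simp add: complex_eq)
  define a where "a c t2 t3 x y y' = complex_of_real (Re c) * x + \<i> * (complex_of_real (Re t2) * y - complex_of_real (Re t3) * y')"
    for c t2 t3 x y y'
  define b where "b c t2 t3 x y y' = complex_of_real (Im c) * x + \<i> * (complex_of_real (Im t2) * y - complex_of_real (Im t3) * y')"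
    for c t2 t3 x y y'
  define a0 where "a0 = Re z1 * w1 + Re z2 * w2 + Re z3 * w3"
  define b0 where "b0 = Im z1 * w1 + Im z2 * w2 + Im z3 * w3"
  have g: "c * x + \<i> * (t2 * y - t3 * y') = a c t2 t3 x y y' + \<i> * b c t2 t3 x y y'" for c t2 t3 x y y'
    by (subst z[of c], subst z[of t2], subst z[of t3]) (simp add: a_def b_def algebra_simps)
  have g0: "z1 * w1 + z2 * w2 + z3 * w3 = a0 + \<i> * b0"
    by (subst z[of z1], subst z[of z2], subst z[of z3]) (simp add: a0_def b0_def algebra_simps)
  have n: "(cmod z)\<^sup>2 = (Re z)\<^sup>2 + (Im z)\<^sup>2" for z by (rule cmod_power2)
  have e: "((cmod z0)\<^sup>2 + (cmod z1)\<^sup>2 + (cmod z2)\<^sup>2 + (cmod z3)\<^sup>2) * W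
    = ((Re z0)\<^sup>2 + (Re z1)\<^sup>2 + (Re z2)\<^sup>2 + (Re z3)\<^sup>2) * W + ((Im z0)\<^sup>2 + (Im z1)\<^sup>2 + (Im z2)\<^sup>2 + (Im z3)\<^sup>2) * W" for W
    unfolding n by (simp add: algebra_simps)
  have R: "(cmod (a z0 z2 z3 w1 w3 w2))\<^sup>2 + (cmod (a z0 z3 z1 w2 w1 w3))\<^sup>2 + (cmod (a z0 z1 z2 w3 w2 w1))\<^sup>2 - (cmod a0)\<^sup>2
    = ((Re z0)\<^sup>2 + (Re z1)\<^sup>2 + (Re z2)\<^sup>2 + (Re z3)\<^sup>2) * ((cmod w1)\<^sup>2 + (cmod w2)\<^sup>2 + (cmod w3)\<^sup>2)
      - 2 * bloch_form (Re z0) (Re z1) (Re z2) (Re z3) w1 w2 w3"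
    unfolding a_def a0_def by (rule bloch_form_real)
  have I: "(cmod (b z0 z2 z3 w1 w3 w2))\<^sup>2 + (cmod (b z0 z3 z1 w2 w1 w3))\<^sup>2 + (cmod (b z0 z1 z2 w3 w2 w1))\<^sup>2 - (cmod b0)\<^sup>2
    = ((Im z0)\<^sup>2 + (Im z1)\<^sup>2 + (Im z2)\<^sup>2 + (Im z3)\<^sup>2) * ((cmod w1)\<^sup>2 + (cmod w2)\<^sup>2 + (cmod w3)\<^sup>2)
      - 2 * bloch_form (Im z0) (Im z1) (Im z2) (Im z3) w1 w2 w3"
    unfolding b_def b0_def by (rule bloch_form_real)
  have C: "Im (cnj (a z0 z2 z3 w1 w3 w2) * b z0 z2 z3 w1 w3 w2) + Im (cnj (a z0 z3 z1 w2 w1 w3) * b z0 z3 z1 w2 w1 w3)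
      + Im (cnj (a z0 z1 z2 w3 w2 w1) * b z0 z1 z2 w3 w2 w1) = Im (cnj a0 * b0)"
    unfolding a_def b_def a0_def b0_def by (rule bloch_form_cross)
  show ?thesis unfolding g g0 unfolding cmod_add_ii_mult e using R I C by linarith
qed

text \<open>The left-hand side is four times \<open>Tr (cnj Z Z)\<close> for \<open>Z = F\<^sup>T P\<close>, where \<open>F\<close> and \<open>P\<close> are the 2 by 2
  coefficient matrices of \<open>\<phi> = (f0, f1, f2, f3)\<close> and \<open>\<psi> = (p0, p1, p1, p3)\<close>. Here
  \<open>2 F\<^sup>T = z0 + z \<bullet> \<sigma>\<close> and \<open>2 P = (w \<bullet> \<sigma>) i \<sigma>2\<close>.\<close>

lemma rank_one_form:
  fixes f0 f1 f2 f3 p0 p1 p3 :: complex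
  defines "w1 \<equiv> p3 - p0" and "w2 \<equiv> - \<i> * (p3 + p0)" and "w3 \<equiv> 2 * p1"
    and "z0 \<equiv> f0 + f3" and "z1 \<equiv> f1 + f2" and "z2 \<equiv> - \<i> * (f1 - f2)" and "z3 \<equiv> f0 - f3"
  shows "4 * ((cmod (f0 * p0 + f2 * p1))\<^sup>2 + (cmod (f1 * p1 + f3 * p3))\<^sup>2
      + 2 * Re (cnj (f0 * p1 + f2 * p3) * (f1 * p0 + f3 * p1)))
    = 2 * ((cmod f0)\<^sup>2 + (cmod f1)\<^sup>2 + (cmod f2)\<^sup>2 + (cmod f3)\<^sup>2) * ((cmod p0)\<^sup>2 + 2 * (cmod p1)\<^sup>2 + (cmod p3)\<^sup>2)
      - bloch_form (Re z0) (Re z1) (Re z2) (Re z3) w1 w2 w3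
      - bloch_form (Im z0) (Im z1) (Im z2) (Im z3) w1 w2 w3"
proof -
  define g0 where "g0 = z1 * w1 + z2 * w2 + z3 * w3"
  define g1 where "g1 = z0 * w1 + \<i> * (z2 * w3 - z3 * w2)"
  define g2 where "g2 = z0 * w2 + \<i> * (z3 * w1 - z1 * w3)"
  define g3 where "g3 = z0 * w3 + \<i> * (z1 * w2 - z2 * w1)"
  note defs = g0_def g1_def g2_def g3_def w1_def w2_def w3_def z0_def z1_def z2_def z3_def
  have par: "(cmod (a - \<i> * b))\<^sup>2 + (cmod (a + \<i> * b))\<^sup>2 = 2 * (cmod a)\<^sup>2 + 2 * (cmod b)\<^sup>2" for a b
    unfolding cmod_power2 by (simp add: power2_eq_square algebra_simps)
  have scale: "16 * ((cmod (- a / 4))\<^sup>2 + (cmod (b / 4))\<^sup>2 + 2 * Re (cnj (c / 4) * (- d / 4)))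
    = (cmod a)\<^sup>2 + (cmod b)\<^sup>2 - 2 * Re (cnj c * d)" for a b c d
    unfolding cmod_power2 by (simp add: power2_eq_square algebra_simps)
  \<comment> \<open>The entries of 4 Z = (g0 + g . sigma) i sigma2, the Pauli expansion of the
    product of the two coefficient matrices.\<close>
  have "4 * (f0 * p0 + f2 * p1) = - (g1 - \<i> * g2)" "4 * (f1 * p1 + f3 * p3) = g1 + \<i> * g2"
    "4 * (f0 * p1 + f2 * p3) = g0 + g3" "4 * (f1 * p0 + f3 * p1) = - (g0 - g3)"
    unfolding defs by (simp_all add: algebra_simps)
  then have Z: "f0 * p0 + f2 * p1 = - (g1 - \<i> * g2) / 4" "f1 * p1 + f3 * p3 = (g1 + \<i> * g2) / 4"
    "f0 * p1 + f2 * p3 = (g0 + g3) / 4" "f1 * p0 + f3 * p1 = - (g0 - g3) / 4"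
    by (simp_all add: field_simps)
  have "16 * ((cmod (f0 * p0 + f2 * p1))\<^sup>2 + (cmod (f1 * p1 + f3 * p3))\<^sup>2
      + 2 * Re (cnj (f0 * p1 + f2 * p3) * (f1 * p0 + f3 * p1)))
    = (cmod (g1 - \<i> * g2))\<^sup>2 + (cmod (g1 + \<i> * g2))\<^sup>2 - 2 * Re (cnj (g0 + g3) * (g0 - g3))"
    unfolding Z by (rule scale)
  also have "\<dots> = 2 * ((cmod g1)\<^sup>2 + (cmod g2)\<^sup>2 + (cmod g3)\<^sup>2 - (cmod g0)\<^sup>2)"
    unfolding par unfolding cmod_power2 by (simp add: power2_eq_square algebra_simps)
  also have "(cmod g1)\<^sup>2 + (cmod g2)\<^sup>2 + (cmod g3)\<^sup>2 - (cmod g0)\<^sup>2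
    = ((cmod z0)\<^sup>2 + (cmod z1)\<^sup>2 + (cmod z2)\<^sup>2 + (cmod z3)\<^sup>2) * ((cmod w1)\<^sup>2 + (cmod w2)\<^sup>2 + (cmod w3)\<^sup>2)
      - 2 * bloch_form (Re z0) (Re z1) (Re z2) (Re z3) w1 w2 w3
      - 2 * bloch_form (Im z0) (Im z1) (Im z2) (Im z3) w1 w2 w3"
    unfolding g0_def g1_def g2_def g3_def by (rule bloch_form_complex)
  also have "(cmod z0)\<^sup>2 + (cmod z1)\<^sup>2 + (cmod z2)\<^sup>2 + (cmod z3)\<^sup>2
    = 2 * ((cmod f0)\<^sup>2 + (cmod f1)\<^sup>2 + (cmod f2)\<^sup>2 + (cmod f3)\<^sup>2)"
    unfolding z0_def z1_def z2_def z3_def cmod_power2 by (simp add: power2_eq_square algebra_simps)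
  also have "(cmod w1)\<^sup>2 + (cmod w2)\<^sup>2 + (cmod w3)\<^sup>2 = 2 * ((cmod p0)\<^sup>2 + 2 * (cmod p1)\<^sup>2 + (cmod p3)\<^sup>2)"
    unfolding w1_def w2_def w3_def cmod_power2 by (simp add: power2_eq_square algebra_simps)
  finally show ?thesis by (simp add: algebra_simps)
qed


section \<open>Averaging over an orthonormal basis of symmetric vectors\<close>

lemma sum_lessThan_3: "(\<Sum>k<3::nat. f k) = f 0 + f 1 + (f 2 :: 'a::comm_monoid_add)"
  by (simp add: eval_nat_numeral ac_simps)

text \<open>Exhibits the form as linear in the products \<open>wi * cnj wj\<close>, so that summing
  it over a frame only needs the Gram sums of the frame.\<close>

lemma bloch_form_gram:
  "bloch_form c t1 t2 t3 w1 w2 w3 = t1\<^sup>2 * Re (w1 * cnj w1) + t2\<^sup>2 * Re (w2 * cnj w2) + t3\<^sup>2 * Re (w3 * cnj w3)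
     + 2 * t1 * t2 * Re (w1 * cnj w2) + 2 * t1 * t3 * Re (w1 * cnj w3) + 2 * t2 * t3 * Re (w2 * cnj w3)
     + 2 * c * (t1 * Im (w2 * cnj w3) - t2 * Im (w1 * cnj w3) + t3 * Im (w1 * cnj w2))"
  unfolding bloch_form_def by (simp add: power2_eq_square algebra_simps)

text \<open>A trace computation: the frame vectors have squared length 2, and the antisymmetric part
  of the matrix, which carries \<open>c\<close>, is traceless.\<close>

lemma bloch_form_sum:
  fixes w1 w2 w3 :: "'a \<Rightarrow> complex"
  assumes "(\<Sum>k\<in>I. w1 k * cnj (w1 k)) = 2" "(\<Sum>k\<in>I. w2 k * cnj (w2 k)) = 2" "(\<Sum>k\<in>I. w3 k * cnj (w3 k)) = 2"
    and "(\<Sum>k\<in>I. w1 k * cnj (w2 k)) = 0" "(\<Sum>k\<in>I. w1 k * cnj (w3 k)) = 0" "(\<Sum>k\<in>I. w2 k * cnj (w3 k)) = 0"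
  shows "(\<Sum>k\<in>I. bloch_form c t1 t2 t3 (w1 k) (w2 k) (w3 k)) = 2 * (t1\<^sup>2 + t2\<^sup>2 + t3\<^sup>2)"
proof -
  note R = assms[THEN arg_cong[of _ _ Re], unfolded Re_sum] and I = assms[THEN arg_cong[of _ _ Im], unfolded Im_sum]
  show ?thesis
    unfolding bloch_form_gram sum.distrib sum_subtractf sum_distrib_left[symmetric] R I
    by (simp add: algebra_simps)
qed

lemma weighted_bloch_form_le:
  fixes w1 w2 w3 :: "nat \<Rightarrow> complex" and \<tau>1 \<tau>2 \<tau>3 c t1 t2 t3 :: real
  assumes \<tau>: "\<tau>1 \<ge> \<tau>2" "\<tau>2 \<ge> \<tau>3" "\<tau>3 \<ge> 0"
    and n: "\<And>k. k < 3 \<Longrightarrow> (cmod (w1 k))\<^sup>2 + (cmod (w2 k))\<^sup>2 + (cmod (w3 k))\<^sup>2 = 2"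
    and s: "(\<Sum>k<3. bloch_form c t1 t2 t3 (w1 k) (w2 k) (w3 k)) = 2 * (t1\<^sup>2 + t2\<^sup>2 + t3\<^sup>2)"
  shows "(\<Sum>k<3. [\<tau>1, \<tau>2, \<tau>3] ! k * bloch_form c t1 t2 t3 (w1 k) (w2 k) (w3 k))
    \<le> (\<tau>1 + sqrt (\<tau>1\<^sup>2 + (\<tau>2 - \<tau>3)\<^sup>2)) * (c\<^sup>2 + t1\<^sup>2 + t2\<^sup>2 + t3\<^sup>2)"
proof -
  define m where "m k = bloch_form c t1 t2 t3 (w1 k) (w2 k) (w3 k) / 2" for k
  define S where "S = sqrt (t1\<^sup>2 + t2\<^sup>2 + t3\<^sup>2)"
  have S: "S\<^sup>2 = t1\<^sup>2 + t2\<^sup>2 + t3\<^sup>2" "S \<ge> 0" by (simp_all add: S_def)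
  have "2 * (\<tau>1 * m 0 + \<tau>2 * m 1 + \<tau>3 * m 2) \<le> (\<tau>1 + sqrt (\<tau>1\<^sup>2 + (\<tau>2 - \<tau>3)\<^sup>2)) * (\<bar>c\<bar>\<^sup>2 + S\<^sup>2)"
  proof (rule weighted_sum_le[OF \<tau>])
    show "m 0 \<le> max (S\<^sup>2) (\<bar>c\<bar> * S)" 
      using bloch_form_bounds(2)[OF n[of 0], of c t1 t2 t3] by (simp add: m_def S_def)
    show "- (\<bar>c\<bar> * S) \<le> m 2"
      using bloch_form_bounds(1)[OF n[of 2], of c t1 t2 t3] by (simp add: m_def S_def)
    show "m 0 + m 1 + m 2 = S\<^sup>2" using s unfolding S sum_lessThan_3 m_def by simp
  qed (use S in auto)
  then show ?thesis unfolding S by (simp add: m_def sum_lessThan_3 algebra_simps)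
qed

text \<open>Summing over the first-qubit indices first turns the left side into the sum over b, b'
  of Z(b', b) times the conjugate of Z(b, b'). Diagonal terms are squared moduli and the two
  off-diagonal terms are conjugate to each other.\<close>

lemma partial_transpose_A_rank_one:
  fixes x :: "complex vec" and p0 p1 p3 :: complex
  defines "p \<equiv> \<lambda>i::nat. if i = 0 then p0 else if i = 3 then p3 else p1"
  shows "(\<Sum>r<4. \<Sum>s<4. cnj (x $ r) * (p (2 * (s div 2) + r mod 2) * cnj (p (2 * (r div 2) + s mod 2))) * x $ s)
    = complex_of_real ((cmod (x $ 0 * p0 + x $ 2 * p1))\<^sup>2 + (cmod (x $ 1 * p1 + x $ 3 * p3))\<^sup>2
      + 2 * Re (cnj (x $ 0 * p1 + x $ 2 * p3) * (x $ 1 * p0 + x $ 3 * p1)))"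
proof -
  have re: "complex_of_real (2 * Re z) = z + cnj z" for z by (simp add: complex_add_cnj)
  have "complex_of_real ((cmod (x $ 0 * p0 + x $ 2 * p1))\<^sup>2 + (cmod (x $ 1 * p1 + x $ 3 * p3))\<^sup>2
      + 2 * Re (cnj (x $ 0 * p1 + x $ 2 * p3) * (x $ 1 * p0 + x $ 3 * p1)))
    = (x $ 0 * p0 + x $ 2 * p1) * cnj (x $ 0 * p0 + x $ 2 * p1) + (x $ 1 * p1 + x $ 3 * p3) * cnj (x $ 1 * p1 + x $ 3 * p3)
      + (cnj (x $ 0 * p1 + x $ 2 * p3) * (x $ 1 * p0 + x $ 3 * p1) + cnj (cnj (x $ 0 * p1 + x $ 2 * p3) * (x $ 1 * p0 + x $ 3 * p1)))"
    unfolding of_real_add[of "_ + _"] re of_real_add complex_norm_square ..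
  then show ?thesis
    by (simp add: p_def sum_lessThan_4 algebra_simps)
qed

text \<open>The columns of \<open>Y\<close> are an arbitrary orthonormal basis of the symmetric
  subspace, so this single estimate covers the whole unitary orbit.\<close>

lemma symmetric_quad_form_ge:
  fixes Y :: "complex mat" and \<tau>1 \<tau>2 \<tau>3 :: real
  assumes Y: "Y \<in> carrier_mat 4 3" and iso: "mat_adjoint Y * Y = 1\<^sub>m 3" and proj: "Y * mat_adjoint Y = sym_proj"
    and sym: "\<And>k. k < 3 \<Longrightarrow> Y $$ (2, k) = Y $$ (1, k)"
    and \<tau>: "\<tau>1 \<ge> \<tau>2" "\<tau>2 \<ge> \<tau>3" "\<tau>3 \<ge> 0" and \<tau>1: "\<tau>1 + \<tau>2 + \<tau>3 = 1" and x: "x \<in> carrier_vec 4"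
  shows "(\<tau>2 + \<tau>3 - sqrt (\<tau>1\<^sup>2 + (\<tau>2 - \<tau>3)\<^sup>2)) / 2 * Re (x \<bullet>c x)
    \<le> Re ((partial_transpose_A (Y * mat_diag 3 (\<lambda>i. of_real ([\<tau>1, \<tau>2, \<tau>3] ! i)) * mat_adjoint Y) *\<^sub>v x) \<bullet>c x)"
proof -
  let ?\<rho> = "Y * mat_diag 3 (\<lambda>i. complex_of_real ([\<tau>1, \<tau>2, \<tau>3] ! i)) * mat_adjoint Y"
  define R where "R = sqrt (\<tau>1\<^sup>2 + (\<tau>2 - \<tau>3)\<^sup>2)"
  define p where "p k i = (if i = 0 then Y $$ (0, k) else if i = 3 then Y $$ (3, k) else Y $$ (1, k))" for k i :: nat
  have p: "Y $$ (i, k) = p k i" if "k < 3" "i < 4" for i k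
    using sym[OF that(1)] that by (auto simp: p_def less4)
  define F where "F k = (cmod (x $ 0 * Y $$ (0, k) + x $ 2 * Y $$ (1, k)))\<^sup>2 + (cmod (x $ 1 * Y $$ (1, k) + x $ 3 * Y $$ (3, k)))\<^sup>2
      + 2 * Re (cnj (x $ 0 * Y $$ (1, k) + x $ 2 * Y $$ (3, k)) * (x $ 1 * Y $$ (0, k) + x $ 3 * Y $$ (1, k)))" for k
  have idx: "2 * (a div 2) + b mod 2 < 4" if "a < 4" for a b :: nat
    using that less_mult_imp_div_less[of a 2 2] mod_less_divisor[of 2 b] by linarith
  have entry: "?\<rho> $$ (i, j) = (\<Sum>k<3. complex_of_real ([\<tau>1, \<tau>2, \<tau>3] ! k) * (p k i * cnj (p k j)))" if "i < 4" "j < 4" for i j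
    unfolding spectral_index[OF Y that] by (intro sum.cong) (auto simp: p[OF _ that(1)] p[OF _ that(2)])
  have "(partial_transpose_A ?\<rho> *\<^sub>v x) \<bullet>c x = (\<Sum>r<4. \<Sum>s<4. cnj (x $ r) *
      ?\<rho> $$ (2 * (s div 2) + r mod 2, 2 * (r div 2) + s mod 2) * x $ s)"
    unfolding quad_form_sum[OF partial_transpose_A_carrier x]
    by (intro sum.cong) (auto simp: partial_transpose_A_def)
  also have "\<dots> = (\<Sum>r<4. \<Sum>s<4. \<Sum>k<3. complex_of_real ([\<tau>1, \<tau>2, \<tau>3] ! k) *
      (cnj (x $ r) * (p k (2 * (s div 2) + r mod 2) * cnj (p k (2 * (r div 2) + s mod 2))) * x $ s))"
    by (intro sum.cong refl) (auto simp: entry[OF idx idx] sum_distrib_left sum_distrib_right mult_ac simp del: index_mult_mat(1))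
  also have "\<dots> = (\<Sum>r<4. \<Sum>k<3. \<Sum>s<4. complex_of_real ([\<tau>1, \<tau>2, \<tau>3] ! k) *
      (cnj (x $ r) * (p k (2 * (s div 2) + r mod 2) * cnj (p k (2 * (r div 2) + s mod 2))) * x $ s))"
    by (intro sum.cong refl sum.swap)
  also have "\<dots> = (\<Sum>k<3. \<Sum>r<4. \<Sum>s<4. complex_of_real ([\<tau>1, \<tau>2, \<tau>3] ! k) *
      (cnj (x $ r) * (p k (2 * (s div 2) + r mod 2) * cnj (p k (2 * (r div 2) + s mod 2))) * x $ s))"
    by (rule sum.swap)
  also have "\<dots> = (\<Sum>k<3. complex_of_real ([\<tau>1, \<tau>2, \<tau>3] ! k) * of_real (F k))"
    unfolding sum_distrib_left[symmetric] F_def p_def partial_transpose_A_rank_one ..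
  also have "\<dots> = of_real (\<Sum>k<3. [\<tau>1, \<tau>2, \<tau>3] ! k * F k)" by simp
  finally have quad: "Re ((partial_transpose_A ?\<rho> *\<^sub>v x) \<bullet>c x) = (\<Sum>k<3. [\<tau>1, \<tau>2, \<tau>3] ! k * F k)" by simp

  have xx: "Re (x \<bullet>c x) = (cmod (x $ 0))\<^sup>2 + (cmod (x $ 1))\<^sup>2 + (cmod (x $ 2))\<^sup>2 + (cmod (x $ 3))\<^sup>2"
    unfolding cscalar_prod_self[OF x] by (simp add: sum_lessThan_4)
  have col: "(cmod (Y $$ (0, k)))\<^sup>2 + 2 * (cmod (Y $$ (1, k)))\<^sup>2 + (cmod (Y $$ (3, k)))\<^sup>2 = 1" if "k < 3" for k
  proof -
    have "complex_of_real ((cmod (Y $$ (0, k)))\<^sup>2 + 2 * (cmod (Y $$ (1, k)))\<^sup>2 + (cmod (Y $$ (3, k)))\<^sup>2) = 1"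
      using isometry_cols[OF Y iso that that]
      unfolding sum_lessThan_4 sym[OF that] of_real_add of_real_mult complex_norm_square by (simp add: algebra_simps)
    then show ?thesis using of_real_eq_1_iff by blast
  qed
  have rows: "(\<Sum>k<3. Y $$ (i, k) * cnj (Y $$ (j, k))) = sym_proj $$ (i, j)" if "i < 4" "j < 4" for i j
    unfolding proj[symmetric] using that Y by (subst index_mult_mat_sum[OF Y mat_adjoint_carrier[OF Y]]) auto

  define w1 where "w1 k = Y $$ (3, k) - Y $$ (0, k)" for k
  define w2 where "w2 k = - \<i> * (Y $$ (3, k) + Y $$ (0, k))" for k
  define w3 where "w3 k = 2 * Y $$ (1, k)" for k
  have wn: "(cmod (w1 k))\<^sup>2 + (cmod (w2 k))\<^sup>2 + (cmod (w3 k))\<^sup>2 = 2" if "k < 3" for k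
  proof -
    have "(cmod (w1 k))\<^sup>2 + (cmod (w2 k))\<^sup>2 + (cmod (w3 k))\<^sup>2
      = 2 * ((cmod (Y $$ (0, k)))\<^sup>2 + 2 * (cmod (Y $$ (1, k)))\<^sup>2 + (cmod (Y $$ (3, k)))\<^sup>2)"
      unfolding w1_def w2_def w3_def cmod_power2 by (simp add: power2_eq_square algebra_simps)
    then show ?thesis using col[OF that] by simp
  qed
  \<comment> \<open>Read off from the rows of \<open>Y Y\<^sup>* = sym_proj\<close>: up to the
    factor sqrt 2 the vectors (w1, w2, w3) form an orthonormal basis of C^3. The entries 1/2 of the
    projector are compensated by the 2 in \<open>w3\<close>.\<close>
  have gram: "(\<Sum>k<3. w1 k * cnj (w1 k)) = 2" "(\<Sum>k<3. w2 k * cnj (w2 k)) = 2" "(\<Sum>k<3. w3 k * cnj (w3 k)) = 2"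
    "(\<Sum>k<3. w1 k * cnj (w2 k)) = 0" "(\<Sum>k<3. w1 k * cnj (w3 k)) = 0" "(\<Sum>k<3. w2 k * cnj (w3 k)) = 0"
    using rows[of 0 0] rows[of 0 1] rows[of 0 3] rows[of 1 0] rows[of 1 1] rows[of 1 3] rows[of 3 0] rows[of 3 1] rows[of 3 3]
    unfolding w1_def w2_def w3_def
    by (simp_all add: sym_proj_entries algebra_simps sum.distrib sum_subtractf sum_negf flip: sum_distrib_left sum_distrib_right)
  define z0 where "z0 = x $ 0 + x $ 3"
  define z1 where "z1 = x $ 1 + x $ 2"
  define z2 where "z2 = - \<i> * (x $ 1 - x $ 2)"
  define z3 where "z3 = x $ 0 - x $ 3"
  define A where "A k = bloch_form (Re z0) (Re z1) (Re z2) (Re z3) (w1 k) (w2 k) (w3 k)" for k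
  define B where "B k = bloch_form (Im z0) (Im z1) (Im z2) (Im z3) (w1 k) (w2 k) (w3 k)" for k
  have F: "4 * F k = 2 * Re (x \<bullet>c x) - A k - B k" if "k < 3" for k
    unfolding F_def rank_one_form xx col[OF that] A_def B_def w1_def w2_def w3_def z0_def z1_def z2_def z3_def by simp
  have sA: "(\<Sum>k<3. [\<tau>1, \<tau>2, \<tau>3] ! k * A k) \<le> (\<tau>1 + R) * ((Re z0)\<^sup>2 + (Re z1)\<^sup>2 + (Re z2)\<^sup>2 + (Re z3)\<^sup>2)"
    unfolding A_def R_def by (intro weighted_bloch_form_le[OF \<tau> wn] bloch_form_sum gram)
  have sB: "(\<Sum>k<3. [\<tau>1, \<tau>2, \<tau>3] ! k * B k) \<le> (\<tau>1 + R) * ((Im z0)\<^sup>2 + (Im z1)\<^sup>2 + (Im z2)\<^sup>2 + (Im z3)\<^sup>2)"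
    unfolding B_def R_def by (intro weighted_bloch_form_le[OF \<tau> wn] bloch_form_sum gram)
  have zz: "(Re z0)\<^sup>2 + (Re z1)\<^sup>2 + (Re z2)\<^sup>2 + (Re z3)\<^sup>2 + ((Im z0)\<^sup>2 + (Im z1)\<^sup>2 + (Im z2)\<^sup>2 + (Im z3)\<^sup>2) = 2 * Re (x \<bullet>c x)"
    unfolding xx cmod_power2 z0_def z1_def z2_def z3_def by (simp add: power2_eq_square algebra_simps)
  have "4 * (\<Sum>k<3. [\<tau>1, \<tau>2, \<tau>3] ! k * F k) = (\<Sum>k<3. [\<tau>1, \<tau>2, \<tau>3] ! k * (4 * F k))"
    by (simp add: sum_distrib_left ac_simps)
  also have "\<dots> = (\<Sum>k<3. [\<tau>1, \<tau>2, \<tau>3] ! k * (2 * Re (x \<bullet>c x) - A k - B k))"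
    by (intro sum.cong) (auto simp: F)
  also have "\<dots> = 2 * Re (x \<bullet>c x) * (\<tau>1 + \<tau>2 + \<tau>3) - (\<Sum>k<3. [\<tau>1, \<tau>2, \<tau>3] ! k * A k) - (\<Sum>k<3. [\<tau>1, \<tau>2, \<tau>3] ! k * B k)"
    by (simp add: sum_lessThan_3 algebra_simps)
  \<comment> \<open>The real and imaginary estimates share the factor \<tau>1 + R, and their squared
    norms add up to twice that of \<open>x\<close>.\<close>
  also have "\<dots> \<ge> 2 * Re (x \<bullet>c x) - (\<tau>1 + R) * (2 * Re (x \<bullet>c x))"
    using sA sB unfolding zz[symmetric] \<tau>1 by (simp add: algebra_simps)
  finally have "2 * Re (x \<bullet>c x) - (\<tau>1 + R) * (2 * Re (x \<bullet>c x)) \<le> 4 * (\<Sum>k<3. [\<tau>1, \<tau>2, \<tau>3] ! k * F k)" .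
  moreover have "2 * Re (x \<bullet>c x) - (\<tau>1 + R) * (2 * Re (x \<bullet>c x)) = 4 * ((\<tau>2 + \<tau>3 - R) / 2 * Re (x \<bullet>c x))"
  proof -
    have "2 * Re (x \<bullet>c x) - (\<tau>1 + R) * (2 * Re (x \<bullet>c x)) = (1 - \<tau>1 - R) * (2 * Re (x \<bullet>c x))"
      by (simp add: left_diff_distrib distrib_right)
    also have "1 - \<tau>1 - R = \<tau>2 + \<tau>3 - R" using \<tau>1 by simp
    finally show ?thesis by simp
  qed
  ultimately show ?thesis unfolding quad R_def by linarith
qed


section \<open>Unitary orbits in the symmetric subspace\<close>

lemma isometry_sandwich_mult:
  fixes K :: "complex mat"
  assumes K: "K \<in> carrier_mat n m" and iso: "mat_adjoint K * K = 1\<^sub>m m"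
    and A: "A \<in> carrier_mat m m" and B: "B \<in> carrier_mat m m"
  shows "(K * A * mat_adjoint K) * (K * B * mat_adjoint K) = K * (A * B) * mat_adjoint K"
proof -
  have Ka: "mat_adjoint K \<in> carrier_mat m n" using K by simp
  note assoc = assoc_mult_mat[of _ n m _ m _ m] assoc_mult_mat[of _ n m _ m _ n] assoc_mult_mat[of _ n m _ n _ n]
    assoc_mult_mat[of _ m m _ n _ n] assoc_mult_mat[of _ m m _ m _ n] assoc_mult_mat[of _ m n _ m _ n] assoc_mult_mat[of _ m n _ m _ m]
    mult_carrier_mat[of _ n m _ m] mult_carrier_mat[of _ n m _ n] mult_carrier_mat[of _ m m _ n]
    mult_carrier_mat[of _ m m _ m] mult_carrier_mat[of _ m n _ m]
  have "(K * A * mat_adjoint K) * (K * B * mat_adjoint K) = K * (A * ((mat_adjoint K * K) * (B * mat_adjoint K)))"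
    using K Ka A B by (simp add: assoc)
  also have "\<dots> = K * (A * (B * mat_adjoint K))"
    unfolding iso left_mult_one_mat[OF mult_carrier_mat[OF B Ka]] ..
  also have "\<dots> = K * (A * B) * mat_adjoint K" using K Ka A B by (simp add: assoc)
  finally show ?thesis .
qed

lemma sandwich_adjoint:
  fixes K :: "complex mat"
  assumes K: "K \<in> carrier_mat n m" and A: "A \<in> carrier_mat m m"
  shows "mat_adjoint (K * A * mat_adjoint K) = K * mat_adjoint A * mat_adjoint K"
  unfolding mat_adjoint_mult[OF mult_carrier_mat[OF K A] mat_adjoint_carrier[OF K]] mat_adjoint_mult[OF K A] mat_adjoint_adjoint
  by (rule assoc_mult_mat[OF K mat_adjoint_carrier[OF A] mat_adjoint_carrier[OF K], symmetric])

lemma sandwich_sandwich: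
  fixes K V :: "complex mat"
  assumes K: "K \<in> carrier_mat n m" and V: "V \<in> carrier_mat m l" and D: "D \<in> carrier_mat l l"
  shows "K * (V * D * mat_adjoint V) * mat_adjoint K = (K * V) * D * mat_adjoint (K * V)"
proof -
  note c = mat_adjoint_carrier[OF K] mat_adjoint_carrier[OF V]
  have "(K * V) * D * mat_adjoint (K * V) = (K * (V * D)) * (mat_adjoint V * mat_adjoint K)"
    using K V D by (simp add: mat_adjoint_mult[OF K V] assoc_mult_mat[of _ n m _ l _ l])
  also have "\<dots> = K * ((V * D) * (mat_adjoint V * mat_adjoint K))"
    using K V D c by (intro assoc_mult_mat[of _ n m _ l _ n] mult_carrier_mat[of _ m l _ l] mult_carrier_mat[of _ l m _ n]) auto
  also have "(V * D) * (mat_adjoint V * mat_adjoint K) = (V * D * mat_adjoint V) * mat_adjoint K"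
    using K V D c by (intro assoc_mult_mat[symmetric, of _ m l _ m _ n] mult_carrier_mat[of _ m l _ l]) auto
  also have "K * ((V * D * mat_adjoint V) * mat_adjoint K) = K * (V * D * mat_adjoint V) * mat_adjoint K"
    using K V D c by (intro assoc_mult_mat[symmetric, of _ n m _ m _ n] mult_carrier_mat[of _ m l _ l] mult_carrier_mat[of _ m l _ m]) auto
  finally show ?thesis by simp
qed

lemma dicke_isometry_entries:
  "dicke_isometry = mat 4 3 (\<lambda>(i, j). if i = 0 \<and> j = 0 \<or> i = 3 \<and> j = 2 then 1
     else if (i = 1 \<or> i = 2) \<and> j = 1 then complex_of_real (1 / sqrt 2) else 0)"
proof -
  have all3: "(\<forall>j<3::nat. P j) \<longleftrightarrow> P 0 \<and> P 1 \<and> P 2" for P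
    by (auto simp: numeral_3_eq_3 less_Suc_eq numeral_2_eq_2)
  show ?thesis
    by (simp add: dicke_isometry_def mat_of_cols_def dicke_entries mat_eq_iff all4 all3)
qed

lemma dicke_isometry_carrier [simp]: "dicke_isometry \<in> carrier_mat 4 3"
  by (simp add: dicke_isometry_entries)

text \<open>Provides the conditions on \<open>Y\<close> in \<open>symmetric_quad_form_ge\<close>;
  right multiplication by a unitary passes from the Dicke basis to an arbitrary orthonormal basis of
  the symmetric subspace.\<close>

lemma dicke_isometry_mult:
  assumes V: "unitary_mat 3 V"
  shows "dicke_isometry * V \<in> carrier_mat 4 3"
    and "mat_adjoint (dicke_isometry * V) * (dicke_isometry * V) = 1\<^sub>m 3"
    and "(dicke_isometry * V) * mat_adjoint (dicke_isometry * V) = sym_proj"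
    and "k < 3 \<Longrightarrow> (dicke_isometry * V) $$ (2, k) = (dicke_isometry * V) $$ (1, k)"
proof -
  let ?K = dicke_isometry
  note K = dicke_isometry_carrier and Vd = unitary_matD[OF V]
  note c = mat_adjoint_carrier[OF K] mat_adjoint_carrier[OF Vd(1)]
  show "?K * V \<in> carrier_mat 4 3" by (rule mult_carrier_mat[OF K Vd(1)])
  have "mat_adjoint (?K * V) * (?K * V) = mat_adjoint V * (mat_adjoint ?K * (?K * V))"
    using c Vd K unfolding mat_adjoint_mult[OF K Vd(1)]
    by (intro assoc_mult_mat[of _ 3 3 _ 4 _ 3] mult_carrier_mat[of _ 4 3 _ 3]) auto
  also have "mat_adjoint ?K * (?K * V) = (mat_adjoint ?K * ?K) * V"
    using c Vd K by (intro assoc_mult_mat[symmetric, of _ 3 4 _ 3 _ 3]) auto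
  finally show "mat_adjoint (?K * V) * (?K * V) = 1\<^sub>m 3" using Vd by (simp add: dicke_isometry_props)
  have "(?K * V) * mat_adjoint (?K * V) = ?K * (V * mat_adjoint V) * mat_adjoint ?K"
    using sandwich_sandwich[OF K Vd(1) one_carrier_mat] Vd(1) right_mult_one_mat[OF Vd(1)]
      right_mult_one_mat[OF mult_carrier_mat[OF K Vd(1)]] by simp
  then show "(?K * V) * mat_adjoint (?K * V) = sym_proj"
    using Vd K by (simp add: dicke_isometry_props right_mult_one_mat[OF K])
  show "(?K * V) $$ (2, k) = (?K * V) $$ (1, k)" if "k < 3"
    using that index_mult_mat_sum[OF K Vd(1), of 2 k] index_mult_mat_sum[OF K Vd(1), of 1 k]
    by (simp add: dicke_isometry_entries sum_lessThan_3)
qed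

lemma density_spectral:
  fixes Y :: "complex mat"
  assumes Y: "Y \<in> carrier_mat n m" "mat_adjoint Y * Y = 1\<^sub>m m"
    and l: "\<And>i. i < m \<Longrightarrow> l i \<ge> 0" "(\<Sum>i<m. l i) = 1"
  shows "density_mat n (Y * mat_diag m (\<lambda>i. of_real (l i)) * mat_adjoint Y)"
  unfolding density_mat_def mat_trace_spectral[OF Y]
  using psd_spectral[OF Y(1) l(1)] l(2) by (simp flip: of_real_sum)

lemma negativity_symmetric_le:
  fixes \<tau>1 \<tau>2 \<tau>3 :: real
  assumes V: "unitary_mat 3 V"
    and \<tau>: "\<tau>1 \<ge> \<tau>2" "\<tau>2 \<ge> \<tau>3" "\<tau>3 \<ge> 0" "\<tau>1 + \<tau>2 + \<tau>3 = 1"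
  shows "negativity ((dicke_isometry * V) * mat_diag 3 (\<lambda>i. of_real ([\<tau>1, \<tau>2, \<tau>3] ! i)) * mat_adjoint (dicke_isometry * V))
    \<le> max 0 (sqrt (\<tau>1\<^sup>2 + (\<tau>2 - \<tau>3)\<^sup>2) - \<tau>2 - \<tau>3)"
proof -
  define R where "R = sqrt (\<tau>1\<^sup>2 + (\<tau>2 - \<tau>3)\<^sup>2)"
  note Y = dicke_isometry_mult[OF V]
  have "negativity ((dicke_isometry * V) * mat_diag 3 (\<lambda>i. of_real ([\<tau>1, \<tau>2, \<tau>3] ! i)) * mat_adjoint (dicke_isometry * V))
    \<le> 2 * (max 0 (R - \<tau>2 - \<tau>3) / 2)"
  proof (rule negativity_le)
    show "density_mat 4 (dicke_isometry * V * mat_diag 3 (\<lambda>i. complex_of_real ([\<tau>1, \<tau>2, \<tau>3] ! i)) * mat_adjoint (dicke_isometry * V))"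
    proof (rule density_spectral[OF Y(1,2)])
      fix i :: nat assume "i < 3"
      then consider "i = 0" | "i = 1" | "i = 2" by linarith
      then show "[\<tau>1, \<tau>2, \<tau>3] ! i \<ge> 0" by cases (use \<tau> in auto)
    qed (use \<tau> in \<open>simp add: sum_lessThan_3\<close>)
    fix x :: "complex vec" assume x: "x \<in> carrier_vec 4"
    have "Re (x \<bullet>c x) \<ge> 0" unfolding cscalar_prod_self[OF x] by (simp add: sum_nonneg)
    \<comment> \<open>The maximum with 0 makes the bound passed to \<open>negativity_le\<close>
      nonnegative and only weakens the estimate.\<close>
    then have "- (max 0 (R - \<tau>2 - \<tau>3) / 2) * Re (x \<bullet>c x) \<le> (\<tau>2 + \<tau>3 - R) / 2 * Re (x \<bullet>c x)"
      by (intro mult_right_mono) auto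
    also have "\<dots> \<le> Re ((partial_transpose_A (dicke_isometry * V * mat_diag 3 (\<lambda>i. complex_of_real ([\<tau>1, \<tau>2, \<tau>3] ! i)) * mat_adjoint (dicke_isometry * V)) *\<^sub>v x) \<bullet>c x)"
      unfolding R_def by (rule symmetric_quad_form_ge[OF Y \<tau> x])
    finally show "- (max 0 (R - \<tau>2 - \<tau>3) / 2) * Re (x \<bullet>c x) \<le> \<dots>" .
  qed simp
  then show ?thesis by (simp add: R_def)
qed

section \<open>Local unitaries, conjugation and phases\<close>

lemma tensor_mat_carrier:
  "A \<in> carrier_mat 2 2 \<Longrightarrow> B \<in> carrier_mat 2 2 \<Longrightarrow> A \<otimes>\<^sub>m B \<in> carrier_mat 4 4"
  by (auto simp: tensor_mat_def)

lemma tensor_mat_index: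
  assumes "A \<in> carrier_mat 2 2" "B \<in> carrier_mat 2 2" "r < 4" "s < 4"
  shows "(A \<otimes>\<^sub>m B) $$ (r, s) = A $$ (r div 2, s div 2) * B $$ (r mod 2, s mod 2)"
  using assms by (auto simp: tensor_mat_def)

lemma sum_lessThan_2: "(\<Sum>k<2::nat. f k) = f 0 + (f 1 :: 'a::comm_monoid_add)"
  by (simp add: eval_nat_numeral ac_simps)

lemma tensor_mat_unitary:
  assumes A: "unitary_mat 2 A" and B: "unitary_mat 2 B"
  shows "unitary_mat 4 (A \<otimes>\<^sub>m B)"
proof (rule unitary_cols)
  note Ad = unitary_matD[OF A] and Bd = unitary_matD[OF B]
  show "A \<otimes>\<^sub>m B \<in> carrier_mat 4 4" by (rule tensor_mat_carrier[OF Ad(1) Bd(1)])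
  fix i j :: nat assume ij: "i < 4" "j < 4"
  then have d: "i div 2 < 2" "j div 2 < 2" "i mod 2 < 2" "j mod 2 < 2" by auto
  have "(\<Sum>k<4. cnj ((A \<otimes>\<^sub>m B) $$ (k, i)) * (A \<otimes>\<^sub>m B) $$ (k, j))
    = (\<Sum>a<2. cnj (A $$ (a, i div 2)) * A $$ (a, j div 2)) * (\<Sum>b<2. cnj (B $$ (b, i mod 2)) * B $$ (b, j mod 2))"
    using ij by (simp add: sum_lessThan_4 sum_lessThan_2 tensor_mat_index[OF Ad(1) Bd(1)] algebra_simps)
  also have "\<dots> = (if i div 2 = j div 2 \<and> i mod 2 = j mod 2 then 1 else 0)"
    using isometry_cols[OF Ad(1,3) d(1,2)] isometry_cols[OF Bd(1,3) d(3,4)] by auto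
  also have "i div 2 = j div 2 \<and> i mod 2 = j mod 2 \<longleftrightarrow> i = j" by (metis div_mult_mod_eq)
  finally show "(\<Sum>k<4. cnj ((A \<otimes>\<^sub>m B) $$ (k, i)) * (A \<otimes>\<^sub>m B) $$ (k, j)) = (if i = j then 1 else 0)" .
qed

lemma unitary_map_cnj:
  assumes A: "unitary_mat n A"
  shows "unitary_mat n (map_mat cnj A)"
proof (rule unitary_cols)
  note Ad = unitary_matD[OF A]
  show "map_mat cnj A \<in> carrier_mat n n" using Ad by simp
  fix i j assume ij: "i < n" "j < n"
  have "(\<Sum>k<n. cnj (map_mat cnj A $$ (k, i)) * map_mat cnj A $$ (k, j)) = cnj (\<Sum>k<n. cnj (A $$ (k, i)) * A $$ (k, j))"
    using Ad ij by (auto intro!: sum.cong)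
  also have "\<dots> = (if i = j then 1 else 0)" unfolding isometry_cols[OF Ad(1,3) ij] by simp
  finally show "(\<Sum>k<n. cnj (map_mat cnj A $$ (k, i)) * map_mat cnj A $$ (k, j)) = (if i = j then 1 else 0)" .
qed

lemma conj_by_index:
  assumes U: "U \<in> carrier_mat n n" and A: "A \<in> carrier_mat n n" and ij: "i < n" "j < n"
  shows "conj_by U A $$ (i, j) = (\<Sum>k<n. \<Sum>l<n. U $$ (i, k) * A $$ (k, l) * cnj (U $$ (j, l)))"
proof -
  have Ua: "mat_adjoint U \<in> carrier_mat n n" using U by simp
  have "conj_by U A $$ (i, j) = (U * (A * mat_adjoint U)) $$ (i, j)"
    unfolding conj_by_def using U A Ua by (simp add: assoc_mult_mat[of _ n n _ n _ n])
  also have "\<dots> = (\<Sum>k<n. U $$ (i, k) * (\<Sum>l<n. A $$ (k, l) * mat_adjoint U $$ (l, j)))"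
    using index_mult_mat_sum[OF U mult_carrier_mat[OF A Ua] ij] index_mult_mat_sum[OF A Ua _ ij(2)] by simp
  also have "\<dots> = (\<Sum>k<n. \<Sum>l<n. U $$ (i, k) * A $$ (k, l) * cnj (U $$ (j, l)))"
    using U ij by (auto simp: sum_distrib_left mult.assoc intro!: sum.cong)
  finally show ?thesis .
qed

lemma conj_by_carrier:
  "U \<in> carrier_mat n n \<Longrightarrow> A \<in> carrier_mat n n \<Longrightarrow> conj_by U A \<in> carrier_mat n n"
  unfolding conj_by_def by (metis mult_carrier_mat mat_adjoint_carrier)

text \<open>Transposition replaces the unitary acting on the first qubit by its entrywise conjugate.
  The result is again a unitary conjugation, so the spectrum of the partial transpose is locally
  invariant.\<close>

lemma partial_transpose_A_conj_tensor:
  assumes V: "V \<in> carrier_mat 2 2" and \<rho>: "\<rho> \<in> carrier_mat 4 4"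
  shows "partial_transpose_A (conj_by (V \<otimes>\<^sub>m V) \<rho>) = conj_by (map_mat cnj V \<otimes>\<^sub>m V) (partial_transpose_A \<rho>)"
    (is "?L = ?R")
proof (rule eq_matI)
  note VV = tensor_mat_carrier[OF V V]
  have V': "map_mat cnj V \<in> carrier_mat 2 2" using V by simp
  note V'V = tensor_mat_carrier[OF V' V]
  note R = conj_by_carrier[OF V'V partial_transpose_A_carrier, of \<rho>]
  show "dim_row ?L = dim_row ?R" "dim_col ?L = dim_col ?R"
    using R by (auto simp: partial_transpose_A_def)
  fix r s assume "r < dim_row ?R" "s < dim_col ?R"
  then have rs: "r < 4" "s < 4" using R by auto
  have idx: "2 * (a div 2) + b mod 2 < 4" if "a < 4" for a b :: nat
    using that less_mult_imp_div_less[of a 2 2] mod_less_divisor[of 2 b] by linarith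
  have cnj_idx: "map_mat cnj V $$ (a, b) = cnj (V $$ (a, b))" if "a < 2" "b < 2" for a b
    using V that by simp
  have dm: "(2 * (a div 2) + b mod 2) div 2 = a div 2" "(2 * (a div 2) + b mod 2) mod 2 = b mod 2" for a b :: nat by auto
  have lt: "r div 2 < 2" "s div 2 < 2" using rs by auto
  have "?L $$ (r, s) = conj_by (V \<otimes>\<^sub>m V) \<rho> $$ (2 * (s div 2) + r mod 2, 2 * (r div 2) + s mod 2)"
    using rs by (simp add: partial_transpose_A_def)
  also have "\<dots> = ?R $$ (r, s)"
    unfolding conj_by_index[OF VV \<rho> idx[OF rs(2)] idx[OF rs(1)]] conj_by_index[OF V'V partial_transpose_A_carrier rs]
    using rs lt
    by (simp add: sum_lessThan_4 tensor_mat_index[OF V V] tensor_mat_index[OF V' V] idx dm cnj_idx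
        partial_transpose_A_def mult_ac flip: numeral_2_eq_2)
  finally show "?L $$ (r, s) = ?R $$ (r, s)" .
qed

lemma quad_form_conj:
  assumes U: "unitary_mat n U" and A: "A \<in> carrier_mat n n" and x: "x \<in> carrier_vec n"
  shows "(conj_by U A *\<^sub>v (U *\<^sub>v x)) \<bullet>c (U *\<^sub>v x) = (A *\<^sub>v x) \<bullet>c x"
proof -
  note Ud = unitary_matD[OF U]
  have Ua: "mat_adjoint U \<in> carrier_mat n n" using Ud by simp
  have Ux: "U *\<^sub>v x \<in> carrier_vec n" using Ud(1) x by (rule mult_mat_vec_carrier)
  have Ax: "A *\<^sub>v x \<in> carrier_vec n" using A x by (rule mult_mat_vec_carrier)
  have id: "mat_adjoint U *\<^sub>v (U *\<^sub>v x) = x" using Ud x by (simp flip: assoc_mult_mat_vec[of _ n n _ n])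
  have "conj_by U A *\<^sub>v (U *\<^sub>v x) = (U * A) *\<^sub>v (mat_adjoint U *\<^sub>v (U *\<^sub>v x))"
    unfolding conj_by_def by (rule assoc_mult_mat_vec[OF mult_carrier_mat[OF Ud(1) A] Ua Ux])
  also have "\<dots> = U *\<^sub>v (A *\<^sub>v x)" unfolding id by (rule assoc_mult_mat_vec[OF Ud(1) A x])
  finally have "(conj_by U A *\<^sub>v (U *\<^sub>v x)) \<bullet>c (U *\<^sub>v x) = (A *\<^sub>v x) \<bullet>c (mat_adjoint U *\<^sub>v (U *\<^sub>v x))"
    using cscalar_prod_adjoint[OF Ud(1) Ax Ux] by simp
  then show ?thesis unfolding id .
qed

lemma det_unitary:
  assumes U: "unitary_mat n U"
  shows "cmod (det U) = 1"
proof -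
  note Ud = unitary_matD[OF U]
  interpret cnj: comm_ring_hom cnj by unfold_locales auto
  have "mat_adjoint U = transpose_mat (map_mat cnj U)" by (rule eq_matI) auto
  then have "det (mat_adjoint U) = cnj (det U)"
    using det_transpose[of "map_mat cnj U" n] Ud(1) by simp
  then have "det U * cnj (det U) = 1"
    using det_mult[OF Ud(1) mat_adjoint_carrier[OF Ud(1)]] Ud(2) by simp
  then have "(cmod (det U))\<^sup>2 = 1" by (metis complex_norm_square of_real_eq_1_iff)
  then show ?thesis by (simp add: power2_eq_1_iff) (metis norm_ge_zero neg_0_le_iff_le not_one_le_zero)
qed

text \<open>A phase adjusts the determinant to 1 and cancels in the conjugation.\<close>

lemma special_unitary_phase:
  assumes U: "unitary_mat 3 U"
  obtains c where "cmod c = 1" "unitary_mat 3 (c \<cdot>\<^sub>m U)" "det (c \<cdot>\<^sub>m U) = 1"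
proof -
  note Ud = unitary_matD[OF U]
  define t where "t = Arg (det U)"
  \<comment> \<open>A cube root of the inverse determinant, since scaling a 3 by 3 matrix by
    \<open>c\<close> multiplies its determinant by \<open>c ^ 3\<close>.\<close>
  define c where "c = cis (- t / 3)"
  have c: "cmod c = 1" by (simp add: c_def)
  have "det U = cis t" using cis_Arg[of "det U"] det_unitary[OF U] unfolding t_def
    by (metis norm_zero sgn_div_norm scaleR_one inverse_1 zero_neq_one)
  moreover have "c ^ 3 = cis (- t)" by (simp add: c_def DeMoivre)
  ultimately have "det (c \<cdot>\<^sub>m U) = 1" using Ud(1) by (simp add: cis_mult)
  moreover have "unitary_mat 3 (c \<cdot>\<^sub>m U)"
  proof (rule unitary_cols)
    show "c \<cdot>\<^sub>m U \<in> carrier_mat 3 3" using Ud by simp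
    fix i j :: nat assume ij: "i < 3" "j < 3"
    have cc: "cnj c * c = 1" using c by (metis complex_norm_square mult.commute of_real_1 one_power2)
    have "(\<Sum>k<3. cnj ((c \<cdot>\<^sub>m U) $$ (k, i)) * (c \<cdot>\<^sub>m U) $$ (k, j)) = (\<Sum>k<3. (cnj c * c) * (cnj (U $$ (k, i)) * U $$ (k, j)))"
      using Ud ij by (intro sum.cong) (auto simp: ac_simps)
    then show "(\<Sum>k<3. cnj ((c \<cdot>\<^sub>m U) $$ (k, i)) * (c \<cdot>\<^sub>m U) $$ (k, j)) = (if i = j then 1 else 0)"
      unfolding cc using isometry_cols[OF Ud(1,3) ij] by simp
  qed
  ultimately show thesis using c that by blast
qed


section \<open>Symmetric states as 3 by 3 matrices in the Dicke basis\<close>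

lemma conj_by_sym_extend:
  assumes U: "U \<in> carrier_mat 3 3" and A: "A \<in> carrier_mat 3 3"
  shows "conj_by (sym_extend U) (sym_extend A) = sym_extend (conj_by U A)"
proof -
  note K = dicke_isometry_carrier and iso = dicke_isometry_props(1)
  note Ua = mat_adjoint_carrier[OF U]
  show ?thesis
    unfolding conj_by_def sym_extend_def sandwich_adjoint[OF K U]
      isometry_sandwich_mult[OF K iso U A] isometry_sandwich_mult[OF K iso mult_carrier_mat[OF U A] Ua] ..
qed

lemma sym_extend_spectral:
  assumes "V \<in> carrier_mat 3 3"
  shows "sym_extend (V * mat_diag 3 d * mat_adjoint V)
    = (dicke_isometry * V) * mat_diag 3 d * mat_adjoint (dicke_isometry * V)"
  unfolding sym_extend_def by (rule sandwich_sandwich[OF dicke_isometry_carrier assms mat_diag_dim])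

lemma sym_restrict_carrier [simp]: "\<rho> \<in> carrier_mat 4 4 \<Longrightarrow> sym_restrict \<rho> \<in> carrier_mat 3 3"
  unfolding sym_restrict_def
  by (rule mult_carrier_mat[OF mult_carrier_mat[OF mat_adjoint_carrier[OF dicke_isometry_carrier]] dicke_isometry_carrier])

lemma sym_extend_restrict:
  assumes \<rho>: "\<rho> \<in> carrier_mat 4 4" and sym: "\<rho> = sym_proj * \<rho> * sym_proj"
  shows "sym_extend (sym_restrict \<rho>) = \<rho>"
proof -
  note K = dicke_isometry_carrier and Ka = mat_adjoint_carrier[OF dicke_isometry_carrier]
  have "sym_extend (sym_restrict \<rho>) = (dicke_isometry * mat_adjoint dicke_isometry) * \<rho> * (dicke_isometry * mat_adjoint dicke_isometry)"
    unfolding sym_extend_def sym_restrict_def using K Ka \<rho>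
    by (simp add: assoc_mult_mat[of _ 4 3 _ 4 _ 4] assoc_mult_mat[of _ 4 3 _ 4 _ 3] assoc_mult_mat[of _ 3 4 _ 4 _ 3] assoc_mult_mat[of _ 3 4 _ 4 _ 4]
        assoc_mult_mat[of _ 4 4 _ 4 _ 4] assoc_mult_mat[of _ 4 3 _ 3 _ 4] assoc_mult_mat[of _ 4 4 _ 3 _ 4] assoc_mult_mat[of _ 3 4 _ 3 _ 4]
        mult_carrier_mat[of _ 4 3 _ 4] mult_carrier_mat[of _ 4 4 _ 3] mult_carrier_mat[of _ 3 4 _ 3] mult_carrier_mat[of _ 3 4 _ 4]
        mult_carrier_mat[of _ 4 4 _ 4])
  then show ?thesis using sym by (simp add: dicke_isometry_props)
qed

lemma sym_restrict_adjoint: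
  assumes \<rho>: "\<rho> \<in> carrier_mat 4 4" and adj: "mat_adjoint \<rho> = \<rho>"
  shows "mat_adjoint (sym_restrict \<rho>) = sym_restrict \<rho>"
  using sandwich_adjoint[OF mat_adjoint_carrier[OF dicke_isometry_carrier] \<rho>] adj
  by (simp add: sym_restrict_def)

text \<open>The order of \<open>l\<close> is arbitrary, which allows one state to be diagonalised
  both in sorted order and in the order of the Dicke mixture.\<close>

lemma symmetric_state_spectral:
  fixes l :: "real list"
  assumes \<rho>: "symmetric_state \<rho>" and len: "length l = 3"
    and cp: "char_poly (sym_restrict \<rho>) = (\<Prod>\<tau>\<leftarrow>l. [:- complex_of_real \<tau>, 1:])"
  obtains W where "unitary_mat 3 W" "\<rho> = sym_extend (W * mat_diag 3 (\<lambda>i. of_real (l ! i)) * mat_adjoint W)"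
proof -
  have r: "\<rho> \<in> carrier_mat 4 4" "mat_adjoint \<rho> = \<rho>" "\<rho> = sym_proj * \<rho> * sym_proj"
    using \<rho> by (auto simp: symmetric_state_def density_mat_def psd_mat_def)
  have "char_poly (sym_restrict \<rho>) = (\<Prod>e\<leftarrow>map of_real l. [:- e, 1:])" unfolding cp by (simp add: comp_def)
  from hermitian_spectral[OF sym_restrict_carrier[OF r(1)] sym_restrict_adjoint[OF r(1,2)] this]
  obtain W where W: "unitary_mat 3 W"
    "sym_restrict \<rho> = W * mat_diag 3 (\<lambda>i. map of_real l ! i) * mat_adjoint W" by auto
  have "mat_diag 3 (\<lambda>i. map complex_of_real l ! i) = mat_diag 3 (\<lambda>i. of_real (l ! i))"
    using len by (intro eq_matI) (auto simp: mat_diag_def)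
  then show thesis using that[OF W(1)] W(2) sym_extend_restrict[OF r(1,3)] by simp
qed

lemma isometry_adjoint_col:
  fixes U :: "complex mat"
  assumes U: "U \<in> carrier_mat n m" and iso: "mat_adjoint U * U = 1\<^sub>m m" and k: "k < m"
  shows "mat_adjoint U *\<^sub>v col U k = unit_vec m k"
  using col_mult2[OF mat_adjoint_carrier[OF U] U k] iso k by simp

lemma symmetric_state_spectrum:
  fixes l :: "real list"
  assumes \<rho>: "symmetric_state \<rho>" and W: "unitary_mat 3 W"
    and eq: "\<rho> = sym_extend (W * mat_diag 3 (\<lambda>i. of_real (l ! i)) * mat_adjoint W)"
  shows "(\<Sum>i<3. l ! i) = 1" and "k < 3 \<Longrightarrow> l ! k \<ge> 0"
proof -
  let ?Y = "dicke_isometry * W"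
  note Y = dicke_isometry_mult[OF W]
  have eq': "\<rho> = ?Y * mat_diag 3 (\<lambda>i. of_real (l ! i)) * mat_adjoint ?Y"
    unfolding eq by (rule sym_extend_spectral[OF unitary_matD(1)[OF W]])
  have psd: "psd_mat 4 \<rho>" and tr: "mat_trace \<rho> = 1" and c: "\<rho> \<in> carrier_mat 4 4"
    using \<rho> by (auto simp: symmetric_state_def density_mat_def psd_mat_def)
  have "complex_of_real (\<Sum>i<3. l ! i) = 1" using tr unfolding eq' mat_trace_spectral[OF Y(1,2)] by simp
  then show "(\<Sum>i<3. l ! i) = 1" using of_real_eq_1_iff by blast
  show "l ! k \<ge> 0" if k: "k < 3"
  proof -
    \<comment> \<open>The k-th eigenvector: the quadratic form of the state at \<open>v\<close> is
      \<open>l ! k\<close>, so positivity of the state gives the sign.\<close>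
    define v where "v = col ?Y k"
    have v: "v \<in> carrier_vec 4" unfolding v_def using Y(1) by (rule col_carrier_vec[OF k, rotated]) 
    have "(mat_adjoint ?Y *\<^sub>v v) $ i = (if i = k then 1 else 0)" if "i < 3" for i
      unfolding v_def using isometry_adjoint_col[OF Y(1,2) k] k that by simp
    then have "(\<Sum>i<3. l ! i * (cmod ((mat_adjoint ?Y *\<^sub>v v) $ i))\<^sup>2) = (\<Sum>i<3. if i = k then l ! k else 0)"
      by (intro sum.cong) auto
    then have "(\<rho> *\<^sub>v v) \<bullet>c v = of_real (l ! k)"
      unfolding eq' quad_form_spectral[OF Y(1) v] using k by simp
    then show ?thesis using psd v by (auto simp: psd_mat_def less_eq_complex_def)
  qed
qed

lemma dicke_mixture_eq:
  "complex_of_real a \<cdot>\<^sub>m ket_bra dicke0 dicke0 + complex_of_real b \<cdot>\<^sub>m ket_bra dicke1 dicke1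
    + complex_of_real c \<cdot>\<^sub>m ket_bra dicke2 dicke2
    = mat 4 4 (\<lambda>(i, j). if i = 0 \<and> j = 0 then of_real a else if i = 3 \<and> j = 3 then of_real c
        else if (i = 1 \<or> i = 2) \<and> (j = 1 \<or> j = 2) then of_real b / 2 else 0)"
proof -
  have "complex_of_real (sqrt 2) * complex_of_real (sqrt 2) = 2" by (simp flip: of_real_mult)
  then show ?thesis by (simp add: ket_bra_def dicke_entries mat_eq_iff all4)
qed

lemma dicke_mixture_sym_extend:
  "complex_of_real a \<cdot>\<^sub>m ket_bra dicke0 dicke0 + complex_of_real b \<cdot>\<^sub>m ket_bra dicke1 dicke1
    + complex_of_real c \<cdot>\<^sub>m ket_bra dicke2 dicke2 = sym_extend (mat_diag 3 (\<lambda>i. of_real ([a, b, c] ! i)))"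
proof -
  have half: "complex_of_real (sqrt 2) * complex_of_real (sqrt 2) = 2" by (simp flip: of_real_mult)
  have "sym_extend (mat_diag 3 (\<lambda>i. complex_of_real ([a, b, c] ! i))) $$ (i, j)
    = (\<Sum>k<3. of_real ([a, b, c] ! k) * dicke_isometry $$ (i, k) * cnj (dicke_isometry $$ (j, k)))" if "i < 4" "j < 4" for i j
    unfolding sym_extend_def by (rule spectral_index[OF dicke_isometry_carrier that])
  moreover have "sym_extend (mat_diag 3 (\<lambda>i. complex_of_real ([a, b, c] ! i))) \<in> carrier_mat 4 4"
    unfolding sym_extend_def by (rule spectral_carrier[OF dicke_isometry_carrier])
  ultimately show ?thesis
    unfolding dicke_mixture_eq
    by (intro eq_matI) (auto simp: less4 sum_lessThan_3 dicke_isometry_entries half simp flip: of_real_mult)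
qed

text \<open>Equal factors commute with the exchange of the qubits, so
  \<open>V \<otimes>\<^sub>m V\<close> maps symmetric vectors to symmetric vectors. In entries: rows
  1 and 2 of its product with the Dicke isometry agree, and \<open>sym_proj\<close> fixes such
  columns. Unitarity of the restriction follows from the intertwining relation.\<close>

lemma tensor_sym_restrict:
  assumes V: "unitary_mat 2 V"
  defines "W \<equiv> sym_restrict (V \<otimes>\<^sub>m V)"
  shows "unitary_mat 3 W" and "dicke_isometry * W = (V \<otimes>\<^sub>m V) * dicke_isometry"
proof -
  let ?K = dicke_isometry and ?T = "V \<otimes>\<^sub>m V"
  note Vc = unitary_matD(1)[OF V]
  note Td = unitary_matD[OF tensor_mat_unitary[OF V V]]
  note K = dicke_isometry_carrier and Ka = mat_adjoint_carrier[OF dicke_isometry_carrier]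
  have W: "W \<in> carrier_mat 3 3" unfolding W_def using Td by simp
  have TK: "?T * ?K \<in> carrier_mat 4 3" by (rule mult_carrier_mat[OF Td(1) K])
  have rows: "(?T * ?K) $$ (2, j) = (?T * ?K) $$ (1, j)" if j: "j < 3" for j
    using j index_mult_mat_sum[OF Td(1) K _ j, of 1] index_mult_mat_sum[OF Td(1) K _ j, of 2]
    by (simp add: sum_lessThan_4 tensor_mat_index[OF Vc Vc] dicke_isometry_entries mult_ac)
  have "?K * W = (?K * mat_adjoint ?K) * (?T * ?K)"
    unfolding W_def sym_restrict_def using K Ka Td
    by (simp add: assoc_mult_mat[of _ 4 3 _ 4 _ 3] assoc_mult_mat[of _ 3 4 _ 4 _ 3] mult_carrier_mat[of _ 4 4 _ 3])
  also have "\<dots> = sym_proj * (?T * ?K)" by (simp add: dicke_isometry_props)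
  also have "\<dots> = ?T * ?K"
  proof (rule eq_matI)
    have P: "sym_proj \<in> carrier_mat 4 4" by (simp add: sym_proj_entries)
    show "dim_row (sym_proj * (?T * ?K)) = dim_row (?T * ?K)" "dim_col (sym_proj * (?T * ?K)) = dim_col (?T * ?K)"
      using P TK by auto
    fix i j assume "i < dim_row (?T * ?K)" "j < dim_col (?T * ?K)"
    then have ij: "i < 4" "j < 3" using TK by auto
    show "(sym_proj * (?T * ?K)) $$ (i, j) = (?T * ?K) $$ (i, j)"
      unfolding index_mult_mat_sum[OF P TK ij] using ij rows[OF ij(2)]
      by (auto simp: less4 sum_lessThan_4 sym_proj_entries simp del: index_mult_mat(1))
  qed
  finally show KW: "?K * W = ?T * ?K" .
  show "unitary_mat 3 W"
  proof (rule unitary_matI[OF W])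
    have "mat_adjoint (?K * W) * (?K * W) = mat_adjoint W * ((mat_adjoint ?K * ?K) * W)"
      unfolding mat_adjoint_mult[OF K W] using K Ka W mat_adjoint_carrier[OF W]
      by (simp add: assoc_mult_mat[of _ 3 3 _ 4 _ 3] assoc_mult_mat[of _ 3 4 _ 3 _ 3] mult_carrier_mat[of _ 4 3 _ 3])
    then have 1: "mat_adjoint (?K * W) * (?K * W) = mat_adjoint W * W" using W by (simp add: dicke_isometry_props)
    have "mat_adjoint (?T * ?K) * (?T * ?K) = mat_adjoint ?K * ((mat_adjoint ?T * ?T) * ?K)"
      unfolding mat_adjoint_mult[OF Td(1) K] using K Ka Td(1) mat_adjoint_carrier[OF Td(1)]
      by (simp add: assoc_mult_mat[of _ 3 4 _ 4 _ 3] assoc_mult_mat[of _ 4 4 _ 4 _ 3] mult_carrier_mat[of _ 4 4 _ 3])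
    then have 2: "mat_adjoint (?T * ?K) * (?T * ?K) = 1\<^sub>m 3"
      using Td K by (simp add: dicke_isometry_props left_mult_one_mat[OF K])
    show "mat_adjoint W * W = 1\<^sub>m 3" using 1 2 KW by simp
  qed
qed

lemma conj_by_tensor_sym_extend:
  assumes V: "unitary_mat 2 V" and A: "A \<in> carrier_mat 3 3"
  shows "conj_by (V \<otimes>\<^sub>m V) (sym_extend A) = sym_extend (conj_by (sym_restrict (V \<otimes>\<^sub>m V)) A)"
proof -
  let ?K = dicke_isometry and ?T = "V \<otimes>\<^sub>m V" and ?W = "sym_restrict (V \<otimes>\<^sub>m V)"
  note K = dicke_isometry_carrier
  note T = unitary_matD(1)[OF tensor_mat_unitary[OF V V]] and W = unitary_matD(1)[OF tensor_sym_restrict(1)[OF V]]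
  show ?thesis unfolding conj_by_def sym_extend_def sandwich_sandwich[OF T K A] sandwich_sandwich[OF K W A]
    tensor_sym_restrict(2)[OF V] ..
qed

section \<open>Unitary orbits and the attaining state\<close>

lemma conj_by_conj_by:
  assumes "U \<in> carrier_mat n n" "V \<in> carrier_mat n n" "A \<in> carrier_mat n n"
  shows "conj_by U (conj_by V A) = conj_by (U * V) A"
  unfolding conj_by_def by (rule sandwich_sandwich[OF assms])

lemma conj_by_smult:
  assumes c: "cmod c = 1" and U: "U \<in> carrier_mat n n" and A: "A \<in> carrier_mat n n"
  shows "conj_by (c \<cdot>\<^sub>m U) A = conj_by U A"
proof (rule eq_matI)
  have cU: "c \<cdot>\<^sub>m U \<in> carrier_mat n n" using U by simp
  note d = conj_by_carrier[OF U A] conj_by_carrier[OF cU A]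
  show "dim_row (conj_by (c \<cdot>\<^sub>m U) A) = dim_row (conj_by U A)" "dim_col (conj_by (c \<cdot>\<^sub>m U) A) = dim_col (conj_by U A)"
    using d by auto
  have cc: "c * cnj c = 1" using c by (metis complex_norm_square of_real_1 one_power2)
  fix i j assume "i < dim_row (conj_by U A)" "j < dim_col (conj_by U A)"
  then have ij: "i < n" "j < n" using d by auto
  have "conj_by (c \<cdot>\<^sub>m U) A $$ (i, j) = (\<Sum>k<n. \<Sum>l<n. (c * cnj c) * (U $$ (i, k) * A $$ (k, l) * cnj (U $$ (j, l))))"
    unfolding conj_by_index[OF cU A ij] using U ij by (intro sum.cong refl) (auto simp: mult_ac)
  then show "conj_by (c \<cdot>\<^sub>m U) A $$ (i, j) = conj_by U A $$ (i, j)"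
    unfolding cc conj_by_index[OF U A ij] by simp
qed

text \<open>\<open>V * mat_adjoint W\<close> carries one eigenbasis to the other; a phase makes its
  determinant 1 without changing the conjugation.\<close>

lemma unitary_orbit_SU3_sym:
  assumes W: "unitary_mat 3 W" and V: "unitary_mat 3 V" and D: "D \<in> carrier_mat 3 3"
  obtains U where "U \<in> SU3_sym" "conj_by U (sym_extend (conj_by W D)) = sym_extend (conj_by V D)"
proof -
  note Wd = unitary_matD[OF W] and Vd = unitary_matD[OF V]
  have VW: "unitary_mat 3 (V * mat_adjoint W)" by (rule unitary_mat_mult[OF V unitary_mat_adjoint[OF W]])
  obtain c where c: "cmod c = 1" "unitary_mat 3 (c \<cdot>\<^sub>m (V * mat_adjoint W))" "det (c \<cdot>\<^sub>m (V * mat_adjoint W)) = 1"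
    using special_unitary_phase[OF VW] .
  note WD = conj_by_carrier[OF Wd(1) D]
  have "conj_by (c \<cdot>\<^sub>m (V * mat_adjoint W)) (conj_by W D) = conj_by (V * mat_adjoint W) (conj_by W D)"
    by (rule conj_by_smult[OF c(1) unitary_matD(1)[OF VW] WD])
  also have "\<dots> = conj_by (V * (mat_adjoint W * W)) D"
    using Wd(1) Vd(1) D unitary_matD(1)[OF VW]
    by (simp add: conj_by_conj_by[of _ 3] assoc_mult_mat[of _ 3 3 _ 3 _ 3])
  also have "\<dots> = conj_by V D" using Wd Vd by simp
  finally have "conj_by (sym_extend (c \<cdot>\<^sub>m (V * mat_adjoint W))) (sym_extend (conj_by W D)) = sym_extend (conj_by V D)"
    by (simp add: conj_by_sym_extend[OF unitary_matD(1)[OF c(2)] WD])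
  moreover have "sym_extend (c \<cdot>\<^sub>m (V * mat_adjoint W)) \<in> SU3_sym" using c by (auto simp: SU3_sym_def)
  ultimately show thesis using that by blast
qed

lemma negativity_tensor_dicke_mixture_ge:
  fixes \<tau>1 \<tau>2 \<tau>3 :: real
  assumes V: "unitary_mat 2 V" and \<tau>1: "\<tau>1 > 0" 
    and \<rho>: "\<rho> = sym_extend (mat_diag 3 (\<lambda>i. of_real ([\<tau>3, \<tau>1, \<tau>2] ! i)))"
    and \<sigma>: "density_mat 4 (conj_by (V \<otimes>\<^sub>m V) \<rho>)"
  shows "sqrt (\<tau>1\<^sup>2 + (\<tau>2 - \<tau>3)\<^sup>2) - \<tau>2 - \<tau>3 \<le> negativity (conj_by (V \<otimes>\<^sub>m V) \<rho>)"
proof -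
  define R where "R = sqrt (\<tau>1\<^sup>2 + (\<tau>2 - \<tau>3)\<^sup>2)"
  define \<Lambda> where "\<Lambda> = (\<tau>2 + \<tau>3 - R) / 2"
  note Vc = unitary_matD(1)[OF V]
  have \<rho>c: "\<rho> \<in> carrier_mat 4 4"
    unfolding \<rho> sym_extend_def by (rule spectral_carrier[OF dicke_isometry_carrier])
  define T where "T = map_mat cnj V \<otimes>\<^sub>m V"
  have T: "unitary_mat 4 T" unfolding T_def by (rule tensor_mat_unitary[OF unitary_map_cnj[OF V] V])
  \<comment> \<open>(\<tau>1 / 2, b) is the eigenvector for \<Lambda> of the block with rows
    (\<tau>3, \<tau>1 / 2) and (\<tau>1 / 2, \<tau>2), by which the partial transpose acts on |++>
    and |-->; \<open>x\<close> is this vector.\<close>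
  define b where "b = \<Lambda> - \<tau>3"
  define x where "x = vec 4 (\<lambda>i. if i = 0 then complex_of_real (\<tau>1 / 2) else if i = 3 then of_real b else 0)"
  have x: "x \<in> carrier_vec 4" by (simp add: x_def)
  have "R\<^sup>2 = \<tau>1\<^sup>2 + (\<tau>2 - \<tau>3)\<^sup>2" by (simp add: R_def)
  \<comment> \<open>The characteristic equation of that block at its smaller root \<Lambda>.\<close>
  then have char: "\<tau>1 * \<tau>1 / 4 = (\<Lambda> - \<tau>2) * b" unfolding b_def \<Lambda>_def by (simp add: power2_eq_square field_simps)
  have "(partial_transpose_A \<rho> *\<^sub>v x) \<bullet>c x = of_real (\<tau>3 * (\<tau>1 / 2)\<^sup>2 + \<tau>2 * b\<^sup>2 + 2 * (\<tau>1 / 2) * (\<tau>1 / 2) * b)"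
    unfolding quad_form_sum[OF partial_transpose_A_carrier x] \<rho> dicke_mixture_sym_extend[symmetric] dicke_mixture_eq
    by (simp add: sum_lessThan_4 partial_transpose_A_def x_def power2_eq_square field_simps)
  also have "\<tau>3 * (\<tau>1 / 2)\<^sup>2 + \<tau>2 * b\<^sup>2 + 2 * (\<tau>1 / 2) * (\<tau>1 / 2) * b = \<Lambda> * ((\<tau>1 / 2)\<^sup>2 + b\<^sup>2)"
  proof -
    have e: "\<tau>3 = \<Lambda> - b" by (simp add: b_def)
    have "\<tau>3 * (\<tau>1 / 2)\<^sup>2 + \<tau>2 * b\<^sup>2 + 2 * (\<tau>1 / 2) * (\<tau>1 / 2) * b - \<Lambda> * ((\<tau>1 / 2)\<^sup>2 + b\<^sup>2)
      = b * (\<tau>1 * \<tau>1 / 4 - (\<Lambda> - \<tau>2) * b)" unfolding e by (simp add: power2_eq_square field_simps)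
    also have "\<dots> = 0" unfolding char by simp
    finally show ?thesis by linarith
  qed
  finally have q: "(partial_transpose_A \<rho> *\<^sub>v x) \<bullet>c x = of_real (\<Lambda> * ((\<tau>1 / 2)\<^sup>2 + b\<^sup>2))" .
  have xx: "x \<bullet>c x = of_real ((\<tau>1 / 2)\<^sup>2 + b\<^sup>2)"
    unfolding cscalar_prod_self[OF x] by (simp add: sum_lessThan_4 x_def power_divide)
  have Tx: "T *\<^sub>v x \<in> carrier_vec 4" using unitary_matD(1)[OF T] x by (rule mult_mat_vec_carrier)
  have h: "conj_by (V \<otimes>\<^sub>m V) \<rho> \<in> carrier_mat 4 4" "mat_adjoint (conj_by (V \<otimes>\<^sub>m V) \<rho>) = conj_by (V \<otimes>\<^sub>m V) \<rho>"
    "mat_trace (conj_by (V \<otimes>\<^sub>m V) \<rho>) = 1"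
    using \<sigma> by (auto simp: density_mat_def psd_mat_def)
  have "- 2 * (\<Lambda> * ((\<tau>1 / 2)\<^sup>2 + b\<^sup>2)) \<le> negativity (conj_by (V \<otimes>\<^sub>m V) \<rho>) * ((\<tau>1 / 2)\<^sup>2 + b\<^sup>2)"
    using negativity_ge[OF h Tx]
    unfolding partial_transpose_A_conj_tensor[OF Vc \<rho>c] T_def[symmetric] quad_form_conj[OF T partial_transpose_A_carrier x] q
      unitary_norm[OF T x] xx Re_complex_of_real .
  then have "(- 2 * \<Lambda>) * ((\<tau>1 / 2)\<^sup>2 + b\<^sup>2) \<le> negativity (conj_by (V \<otimes>\<^sub>m V) \<rho>) * ((\<tau>1 / 2)\<^sup>2 + b\<^sup>2)" by simp
  \<comment> \<open>The test vector is nonzero because \<tau>1 is positive, so its squared norm can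
    be cancelled.\<close>
  moreover have "(\<tau>1 / 2)\<^sup>2 + b\<^sup>2 > 0" using \<tau>1 by (simp add: add_pos_nonneg)
  ultimately have "- 2 * \<Lambda> \<le> negativity (conj_by (V \<otimes>\<^sub>m V) \<rho>)" by (rule mult_right_le_imp_le)
  then show ?thesis unfolding \<Lambda>_def R_def by simp
qed

theorem theorem1:
  fixes \<rho> :: "complex mat" and \<tau>1 \<tau>2 \<tau>3 :: real
  assumes "symmetric_state \<rho>"
    and "char_poly (sym_restrict \<rho>) = (\<Prod>\<tau>\<leftarrow>[\<tau>1, \<tau>2, \<tau>3]. [:- complex_of_real \<tau>, 1:])"
    and "\<tau>1 \<ge> \<tau>2" and "\<tau>2 \<ge> \<tau>3"
  shows
    "let Nmax = max 0 (sqrt (\<tau>1\<^sup>2 + (\<tau>2 - \<tau>3)\<^sup>2) - \<tau>2 - \<tau>3);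
         \<rho>max = complex_of_real \<tau>3 \<cdot>\<^sub>m ket_bra dicke0 dicke0
              + complex_of_real \<tau>1 \<cdot>\<^sub>m ket_bra dicke1 dicke1
              + complex_of_real \<tau>2 \<cdot>\<^sub>m ket_bra dicke2 dicke2
     in (\<forall>U \<in> SU3_sym. negativity (conj_by U \<rho>) \<le> Nmax) \<and>
        (\<exists>U \<in> SU3_sym. negativity (conj_by U \<rho>) = Nmax) \<and>
        (\<exists>U \<in> SU3_sym. conj_by U \<rho> = \<rho>max \<and> negativity \<rho>max = Nmax) \<and>
        (\<forall>V. unitary_mat 2 V \<longrightarrow>
          (\<exists>U \<in> SU3_sym. conj_by U \<rho> = conj_by (V \<otimes>\<^sub>m V) \<rho>max \<and>
             negativity (conj_by (V \<otimes>\<^sub>m V) \<rho>max) = Nmax))"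
proof -
  define N where "N = max 0 (sqrt (\<tau>1\<^sup>2 + (\<tau>2 - \<tau>3)\<^sup>2) - \<tau>2 - \<tau>3)"
  define \<rho>max where "\<rho>max = complex_of_real \<tau>3 \<cdot>\<^sub>m ket_bra dicke0 dicke0
              + complex_of_real \<tau>1 \<cdot>\<^sub>m ket_bra dicke1 dicke1
              + complex_of_real \<tau>2 \<cdot>\<^sub>m ket_bra dicke2 dicke2"
  let ?D = "mat_diag 3 (\<lambda>i. complex_of_real ([\<tau>1, \<tau>2, \<tau>3] ! i))"
    and ?E = "mat_diag 3 (\<lambda>i. complex_of_real ([\<tau>3, \<tau>1, \<tau>2] ! i))"
  obtain W where W: "unitary_mat 3 W" and \<rho>W: "\<rho> = sym_extend (W * ?D * mat_adjoint W)"
    using symmetric_state_spectral[OF assms(1) _ assms(2)] by auto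
  \<comment> \<open>The characteristic polynomial does not see the order of its roots; the second
    diagonalisation lists them as they occur along the Dicke basis in the target state.\<close>
  have "char_poly (sym_restrict \<rho>) = (\<Prod>\<tau>\<leftarrow>[\<tau>3, \<tau>1, \<tau>2]. [:- complex_of_real \<tau>, 1:])"
    unfolding assms(2) by (simp only: list.map prod_list.Cons prod_list.Nil mult_ac)
  then obtain W' where W': "unitary_mat 3 W'" and \<rho>W': "\<rho> = sym_extend (conj_by W' ?E)"
    using symmetric_state_spectral[OF assms(1), of "[\<tau>3, \<tau>1, \<tau>2]"] by (auto simp: conj_by_def)
  have \<tau>: "\<tau>3 \<ge> 0" "\<tau>1 + \<tau>2 + \<tau>3 = 1"
    using symmetric_state_spectrum(2)[OF assms(1) W \<rho>W, of 2] symmetric_state_spectrum(1)[OF assms(1) W \<rho>W]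
    by (simp_all add: sum_lessThan_3)
  have \<tau>1: "\<tau>1 > 0" using \<tau> assms(3,4) by linarith
  have upper: "negativity (conj_by U \<rho>) \<le> N \<and> density_mat 4 (conj_by U \<rho>)" if US: "U \<in> SU3_sym" for U
  proof -
    obtain U0 where U0: "unitary_mat 3 U0" and U: "U = sym_extend U0" using US by (auto simp: SU3_sym_def)
    note U0c = unitary_matD(1)[OF U0] and Wc = unitary_matD(1)[OF W]
    have UW: "unitary_mat 3 (U0 * W)" by (rule unitary_mat_mult[OF U0 W])
    have "conj_by U \<rho> = sym_extend (conj_by U0 (conj_by W ?D))"
      unfolding U \<rho>W conj_by_def[of W, symmetric] by (rule conj_by_sym_extend[OF U0c conj_by_carrier[OF Wc mat_diag_dim]])
    also have "\<dots> = sym_extend ((U0 * W) * ?D * mat_adjoint (U0 * W))"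
      unfolding conj_by_conj_by[OF U0c Wc mat_diag_dim] unfolding conj_by_def ..
    finally have eq: "conj_by U \<rho> = (dicke_isometry * (U0 * W)) * ?D * mat_adjoint (dicke_isometry * (U0 * W))"
      unfolding sym_extend_spectral[OF unitary_matD(1)[OF UW]] .
    have "density_mat 4 (conj_by U \<rho>)"
      unfolding eq using symmetric_state_spectrum[OF assms(1) W \<rho>W] by (intro density_spectral dicke_isometry_mult[OF UW])
    then show ?thesis
      using negativity_symmetric_le[OF UW assms(3,4) \<tau>] unfolding eq N_def by simp
  qed
  have \<rho>max: "\<rho>max = sym_extend ?E" unfolding \<rho>max_def by (rule dicke_mixture_sym_extend)
  have local: "\<exists>U \<in> SU3_sym. conj_by U \<rho> = conj_by (V \<otimes>\<^sub>m V) \<rho>max \<and> negativity (conj_by (V \<otimes>\<^sub>m V) \<rho>max) = N"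
    if V: "unitary_mat 2 V" for V
  proof -
    obtain U where U: "U \<in> SU3_sym" and "conj_by U \<rho> = sym_extend (conj_by (sym_restrict (V \<otimes>\<^sub>m V)) ?E)"
      unfolding \<rho>W' using unitary_orbit_SU3_sym[OF W' tensor_sym_restrict(1)[OF V] mat_diag_dim] .
    then have eq: "conj_by U \<rho> = conj_by (V \<otimes>\<^sub>m V) \<rho>max"
      unfolding \<rho>max conj_by_tensor_sym_extend[OF V mat_diag_dim] by simp
    have dens: "density_mat 4 (conj_by (V \<otimes>\<^sub>m V) \<rho>max)" and le: "negativity (conj_by (V \<otimes>\<^sub>m V) \<rho>max) \<le> N"
      using upper[OF U] unfolding eq by auto
    \<comment> \<open>The test vector yields only the second argument of the maximum; nonnegativity
      supplies the first.\<close>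
    have "negativity (conj_by (V \<otimes>\<^sub>m V) \<rho>max) \<ge> 0"
      using dens by (intro negativity_nonneg) (auto simp: density_mat_def psd_mat_def)
    with negativity_tensor_dicke_mixture_ge[OF V \<tau>1 \<rho>max dens] le U eq show ?thesis
      unfolding N_def by auto
  qed
  \<comment> \<open>The target state itself is the case V = 1 of the local statement.\<close>
  have one: "unitary_mat 2 (1\<^sub>m 2)" by (simp add: unitary_mat_def)
  have "1\<^sub>m 2 \<otimes>\<^sub>m 1\<^sub>m 2 = (1\<^sub>m 4 :: complex mat)"
    by (simp add: tensor_mat_def mat_eq_iff all4)
  then have "conj_by (1\<^sub>m 2 \<otimes>\<^sub>m 1\<^sub>m 2) \<rho>max = \<rho>max"
    using spectral_carrier[OF dicke_isometry_carrier] unfolding \<rho>max sym_extend_def conj_by_def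
    by (simp add: left_mult_one_mat[of _ 4 4] right_mult_one_mat[of _ 4 4])
  with local[OF one] have "\<exists>U \<in> SU3_sym. conj_by U \<rho> = \<rho>max \<and> negativity \<rho>max = N" by simp
  with upper local show ?thesis
    unfolding Let_def N_def[symmetric] \<rho>max_def[symmetric] by metis
qed

end
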